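(* Let $p>1$ and let $(X_t)_{t\le T}$ be a non-negative càdlàg submartingale. (i) Then $$\mathbb{E}[\bar X_T^p]\ \overset{(a)}{\le}\ \mathrm{UB}\Big(X,\mathrm{pow}^p,\zeta_{\frac{p-1}{p}}\Big)\ \overset{(b)}{\le}\ \Big(\frac{p}{p-1}\Big)^p\mathbb{E}[X_T^p]-\frac{p}{p-1}X_0^p .$$ (ii) For every $\epsilon>0$ there exists a martingale $X$ such that $$0\le\Big(\frac p{p-1}\Big)^p\mathbb{E}[X_T^p]-\frac p{p-1}X_0^p-\mathbb{E}[\bar X_T^p]<\epsilon .$$ (iii) Inequality (b) is strict if and only if either of the following holds: - $\mathbb{E}[\bar X_T^p]<\infty$ and $X_T<\frac{p-1}{p}X_0$ with positive probability; - $\mathbb{E}[\bar X_T^p]<\infty$ and $X$ is a strict submartingale (i.e. a submartingale that is not a martingale).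
   Context: $T$ is a fixed time horizon; the underlying filtered probability space supports a standard Brownian motion with some initial value $X_0$, and $X_0$ (a constant) is also the initial value of the processes $X$. Martingales and submartingales are with respect to their own natural filtration; $\bar X_T:=\sup_{t\le T}X_t$. Notation: $\mathrm{pow}^p(m)=m^p$ and $\zeta_\alpha(m):=\alpha m$. For a right-continuous non-decreasing $\phi$ and a single function $\zeta$ with $\zeta(m)<m$, $$\mathrm{UB}(X,\phi,\zeta):=\phi(X_0)+\int_{(X_0,\infty)}\mathbb{E}\left[\frac{(X_T-\zeta(m))^+}{m-\zeta(m)}\right]\mathrm{d}\phi(m).$$
   Formalization: Part (iii) is proved for X_0 > 0 only: if X_0 = 0, then (b) is always an equality, so (iii) fails, e.g. for the strict submartingale |B| started at 0 and stopped at level 1. *)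

theory Defs
  imports "HOL-Probability.Probability"
begin

subsection \<open>Filtrations, Brownian motion, martingales\<close>

text \<open>Time is \<^typ>\<open>real\<close>; only nonnegative times are constrained, and for processes on
  the horizon \<open>{0..T}\<close> only the times in \<open>{0..T}\<close>.\<close>

definition filtered_prob_space :: "'a measure \<Rightarrow> (real \<Rightarrow> 'a measure) \<Rightarrow> bool" where
  "filtered_prob_space M F \<longleftrightarrow>
     prob_space M \<and>
     (\<forall>t\<ge>0. subalgebra M (F t)) \<and>
     (\<forall>s t. 0 \<le> s \<and> s \<le> t \<longrightarrow> sets (F s) \<subseteq> sets (F t))"

definition brownian_motion ::
  "'a measure \<Rightarrow> (real \<Rightarrow> 'a measure) \<Rightarrow> real \<Rightarrow> (real \<Rightarrow> 'a \<Rightarrow> real) \<Rightarrow> bool" where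
  "brownian_motion M F x B \<longleftrightarrow>
     (\<forall>t\<ge>0. B t \<in> borel_measurable (F t)) \<and>
     (AE \<omega> in M. B 0 \<omega> = x) \<and>
     (AE \<omega> in M. continuous_on {0..} (\<lambda>t. B t \<omega>)) \<and>
     (\<forall>s t. 0 \<le> s \<and> s < t \<longrightarrow>
        distributed M lborel (\<lambda>\<omega>. B t \<omega> - B s \<omega>) (normal_density 0 (sqrt (t - s))) \<and>
        prob_space.indep_set M (sets (F s))
          (sets (vimage_algebra (space M) (\<lambda>\<omega>. B t \<omega> - B s \<omega>) borel)))"

definition natural_filtration ::
  "'a measure \<Rightarrow> (real \<Rightarrow> 'a \<Rightarrow> real) \<Rightarrow> real \<Rightarrow> 'a measure" where
  "natural_filtration M X t =
     sigma (space M) {X s -` A \<inter> space M | s A. s \<in> {0..t} \<and> A \<in> sets borel}"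

definition submartingale_wrt ::
  "'a measure \<Rightarrow> (real \<Rightarrow> 'a measure) \<Rightarrow> real \<Rightarrow> (real \<Rightarrow> 'a \<Rightarrow> real) \<Rightarrow> bool" where
  "submartingale_wrt M F T X \<longleftrightarrow>
     (\<forall>t\<in>{0..T}. X t \<in> borel_measurable (F t) \<and> integrable M (X t)) \<and>
     (\<forall>s t. 0 \<le> s \<and> s \<le> t \<and> t \<le> T \<longrightarrow>
        (AE \<omega> in M. X s \<omega> \<le> real_cond_exp M (F s) (X t) \<omega>))"

definition martingale_wrt ::
  "'a measure \<Rightarrow> (real \<Rightarrow> 'a measure) \<Rightarrow> real \<Rightarrow> (real \<Rightarrow> 'a \<Rightarrow> real) \<Rightarrow> bool" where
  "martingale_wrt M F T X \<longleftrightarrow>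
     (\<forall>t\<in>{0..T}. X t \<in> borel_measurable (F t) \<and> integrable M (X t)) \<and>
     (\<forall>s t. 0 \<le> s \<and> s \<le> t \<and> t \<le> T \<longrightarrow>
        (AE \<omega> in M. X s \<omega> = real_cond_exp M (F s) (X t) \<omega>))"

definition submartingale :: "'a measure \<Rightarrow> real \<Rightarrow> (real \<Rightarrow> 'a \<Rightarrow> real) \<Rightarrow> bool" where
  "submartingale M T X \<longleftrightarrow> submartingale_wrt M (natural_filtration M X) T X"

definition martingale :: "'a measure \<Rightarrow> real \<Rightarrow> (real \<Rightarrow> 'a \<Rightarrow> real) \<Rightarrow> bool" where
  "martingale M T X \<longleftrightarrow> martingale_wrt M (natural_filtration M X) T X"

definition cadlag :: "'a measure \<Rightarrow> real \<Rightarrow> (real \<Rightarrow> 'a \<Rightarrow> real) \<Rightarrow> bool" where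
  "cadlag M T X \<longleftrightarrow> (\<forall>\<omega>\<in>space M.
     (\<forall>t\<in>{0..<T}. continuous (at_right t) (\<lambda>s. X s \<omega>)) \<and>
     (\<forall>t\<in>{0<..T}. \<exists>l. ((\<lambda>s. X s \<omega>) \<longlongrightarrow> l) (at_left t)))"

definition nonneg_process :: "'a measure \<Rightarrow> real \<Rightarrow> (real \<Rightarrow> 'a \<Rightarrow> real) \<Rightarrow> bool" where
  "nonneg_process M T X \<longleftrightarrow> (\<forall>t\<in>{0..T}. \<forall>\<omega>\<in>space M. 0 \<le> X t \<omega>)"

definition starts_at :: "'a measure \<Rightarrow> real \<Rightarrow> (real \<Rightarrow> 'a \<Rightarrow> real) \<Rightarrow> bool" where
  "starts_at M x X \<longleftrightarrow> (AE \<omega> in M. X 0 \<omega> = x)"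

text \<open>The real-valued supremum is only meaningful for paths that are bounded above on
  \<open>{0..T}\<close>; cadlag paths are.\<close>

definition running_max :: "(real \<Rightarrow> 'a \<Rightarrow> real) \<Rightarrow> real \<Rightarrow> 'a \<Rightarrow> real" where
  "running_max X T \<omega> = (SUP t\<in>{0..T}. X t \<omega>)"

subsection \<open>The upper bound\<close>

text \<open>Expectation of a nonnegative random variable, possibly infinite; negative values
  are truncated to 0.\<close>

definition expect_nonneg :: "'a measure \<Rightarrow> ('a \<Rightarrow> real) \<Rightarrow> ereal" where
  "expect_nonneg M f = enn2ereal (\<integral>\<^sup>+\<omega>. ennreal (f \<omega>) \<partial>M)"

definition pow :: "real \<Rightarrow> real \<Rightarrow> real" where
  "pow p m = m powr p"

definition zeta :: "real \<Rightarrow> real \<Rightarrow> real" where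
  "zeta \<alpha> m = \<alpha> * m"

text \<open>Only the restriction of \<open>d\<phi>\<close> to \<open>(x0, \<infinity>)\<close> enters. Freezing \<open>\<phi>\<close> to the left of
  \<open>x0\<close> leaves that restriction unchanged, while making \<^const>\<open>interval_measure\<close> well
  behaved also for \<open>\<phi>\<close> that is monotone and right-continuous on \<open>[x0, \<infinity>)\<close> only, such as
  a real power.\<close>

definition UB ::
  "'a measure \<Rightarrow> real \<Rightarrow> real \<Rightarrow> (real \<Rightarrow> 'a \<Rightarrow> real) \<Rightarrow> (real \<Rightarrow> real) \<Rightarrow> (real \<Rightarrow> real) \<Rightarrow> ereal"
  where
  "UB M T x0 X \<phi> \<zeta> =
     ereal (\<phi> x0) +
     enn2ereal (\<integral>\<^sup>+m\<in>{x0<..}.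
        (\<integral>\<^sup>+\<omega>. ennreal (max 0 (X T \<omega> - \<zeta> m) / (m - \<zeta> m)) \<partial>M)
        \<partial>interval_measure (\<lambda>m. \<phi> (max x0 m)))"

definition doob_bound ::
  "'a measure \<Rightarrow> real \<Rightarrow> real \<Rightarrow> real \<Rightarrow> (real \<Rightarrow> 'a \<Rightarrow> real) \<Rightarrow> ereal" where
  "doob_bound M T p x0 X =
     ereal ((p / (p - 1)) powr p) * expect_nonneg M (\<lambda>\<omega>. X T \<omega> powr p)
     - ereal (p / (p - 1) * x0 powr p)"

end

theory Submission
  imports Defs
begin

text \<open>
  Write \<open>\<alpha> = (p - 1) / p\<close>.

  \<^bold>\<open>The two inequalities.\<close>  Doob's maximal inequality bounds \<open>P(max X > m)\<close> by
  \<open>E (X\<^sub>T - \<zeta>)\<^sup>+ / (m - \<zeta>)\<close> for \<^emph>\<open>every\<close> level \<open>\<zeta> < m\<close>, and the level may depend on \<open>m\<close>.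
  Integrating over \<open>m\<close> against \<open>d(m\<^sup>p)\<close> turns the left-hand side into \<open>E (max X)\<^sup>p\<close> (layer cake)
  and the right-hand side into \<open>UB\<close>, once \<open>x\<^sub>0\<^sup>p\<close> is added on both sides for the levels
  up to \<open>x\<^sub>0\<close>. This is (a): lemmas \<open>submartingale_maximal_ineq_finite\<close> and
  \<open>expect_running_max_powr_le_UB\<close>.

  For \<open>\<zeta> = \<alpha> m\<close>, interchanging the two integrals in \<open>UB\<close> reduces it to a one-dimensional integral
  over \<open>m\<close> for each value \<open>y\<close> of \<open>X\<^sub>T\<close>, and this integral is elementary
  (\<open>nn_integral_stop_loss_pow_measure\<close>): it vanishes for
  \<open>y < \<alpha> x\<^sub>0\<close>, and for \<open>y \<ge> \<alpha> x\<^sub>0\<close> it is \<open>k(y)\<close>, the gap between the convex function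
  \<open>(p / (p - 1))\<^sup>p y\<^sup>p\<close> and its tangent at \<open>\<alpha> x\<^sub>0\<close>. Since the tangent is affine with slope
  \<open>p\<^sup>2 / (p - 1) \<cdot> x\<^sub>0 powr (p - 1)\<close>, taking expectations gives the identity

    \<open>Doob bound - UB = E[k(X\<^sub>T); X\<^sub>T < \<alpha> x\<^sub>0] + p\<^sup>2 / (p - 1) \<cdot> x\<^sub>0 powr (p - 1) \<cdot> (E X\<^sub>T - x\<^sub>0)\<close>

  whenever \<open>E X\<^sub>T\<^sup>p\<close> is finite (\<open>doob_bound_eq_UB_plus_slack\<close>). Both summands are
  nonnegative, which is (b). For \<open>x\<^sub>0 > 0\<close> the first is positive exactly if \<open>X\<^sub>T < \<alpha> x\<^sub>0\<close> with positive probability (the convexity is strict) and the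
  second exactly if \<open>X\<close> is not a martingale (a submartingale with constant expectation is one), which
  is (iii). If \<open>E X\<^sub>T\<^sup>p\<close> is infinite, so is \<open>E (max X)\<^sup>p\<close>, hence \<open>UB\<close> by (a): no strict inequality.

  \<^bold>\<open>Sharpness.\<close>  Equality is approached by a process that climbs along a deterministic path and jumps
  down once, to a fixed fraction \<open>c\<close> of its maximum, where it stays. Let the level of the jump be
  \<open>x\<^sub>0 V\<close> with \<open>P(V > v) = v\<^sup>-\<^sup>q\<close> for \<open>v \<ge> 1\<close>. The process is a martingale if \<open>c = (q - 1) / q\<close>,
  because then the expected loss at the jump balances the climb
  (\<open>jump_process_martingale\<close>); its maximum is \<open>x\<^sub>0 V\<close> and its terminal
  value is \<open>x\<^sub>0 c V\<close>. Both have finite \<open>p\<close>-th moment for \<open>q > p\<close>, and the explicit gap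
  in Doob's inequality vanishes as \<open>q\<close> decreases to \<open>p\<close>. The Brownian motion is only a source of
  randomness: its increment over \<open>[0, T]\<close>, sent through its distribution function, is uniform, from
  which \<open>V\<close> is obtained by a power.
\<close>

section \<open>The Stieltjes measure of a power\<close>

text \<open>The derivative is required in the open interval only, since \<open>m powr p\<close> need not be differentiable
at \<open>0\<close>, which is the left end point when the processes start at \<open>0\<close>.\<close>

lemma nn_integral_FTC_open:
  fixes F f :: "real \<Rightarrow> real"
  assumes "a \<le> b" and cont: "continuous_on {a..b} F"
    and deriv: "\<And>x. a < x \<Longrightarrow> x < b \<Longrightarrow> (F has_real_derivative f x) (at x)"
    and nonneg: "\<And>x. a < x \<Longrightarrow> x < b \<Longrightarrow> 0 \<le> f x"
  shows "(\<integral>\<^sup>+x. ennreal (f x) * indicator {a<..<b} x \<partial>lborel) = ennreal (F b - F a)"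
proof -
  define f' where "f' x = (if a < x \<and> x < b then f x else 0)" for x
  have "(f' has_integral (F b - F a)) {a..b}"
    using \<open>a \<le> b\<close> cont deriv
    by (intro fundamental_theorem_of_calculus_interior)
       (auto simp: f'_def has_real_derivative_iff_has_vector_derivative[symmetric])
  then have "(\<integral>\<^sup>+x. ennreal (f' x) * indicator {a..b} x \<partial>lborel) = ennreal (F b - F a)"
    by (rule nn_integral_has_integral_lebesgue'[rotated]) (auto simp: f'_def intro: nonneg)
  also have "(\<integral>\<^sup>+x. ennreal (f' x) * indicator {a..b} x \<partial>lborel)
      = (\<integral>\<^sup>+x. ennreal (f x) * indicator {a<..<b} x \<partial>lborel)"
    by (intro nn_integral_cong) (auto simp: f'_def indicator_def)
  finally show ?thesis .
qed

lemma continuous_on_powr_nonneg: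
  fixes r :: real
  assumes "0 < r" "S \<subseteq> {0..}"
  shows "continuous_on S (\<lambda>x. x powr r)"
  using assms by (intro continuous_on_powr' continuous_intros) auto

lemma powr_pred_mult:
  fixes x r :: real
  assumes "0 \<le> x"
  shows "x powr (r - 1) * x = x powr r"
  using powr_mult_base[OF assms, of "r - 1"] by (simp add: mult.commute)

lemma nn_integral_powr_deriv:
  assumes "0 \<le> a" "a \<le> b" "0 < p"
  shows "(\<integral>\<^sup>+x. ennreal (p * x powr (p - 1)) * indicator {a<..<b} x \<partial>lborel)
    = ennreal (b powr p - a powr p)"
  using assms
  by (intro nn_integral_FTC_open continuous_on_powr_nonneg)
     (auto intro!: derivative_eq_intros)

abbreviation pow_measure :: "real \<Rightarrow> real \<Rightarrow> real measure" where
  "pow_measure p x0 \<equiv> interval_measure (\<lambda>m. pow p (max x0 m))"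

lemma
  assumes "0 \<le> x0" "0 < p"
  shows pow_max_mono: "m \<le> m' \<Longrightarrow> pow p (max x0 m) \<le> pow p (max x0 m')"
    and pow_max_right_cont: "continuous (at_right m) (\<lambda>m. pow p (max x0 m))"
proof -
  show "m \<le> m' \<Longrightarrow> pow p (max x0 m) \<le> pow p (max x0 m')"
    using assms by (auto simp: pow_def intro!: powr_mono2)
  have "continuous_on UNIV (\<lambda>m. max x0 m powr p)"
    using assms by (intro continuous_on_powr' continuous_intros) (auto simp: max_def)
  then show "continuous (at_right m) (\<lambda>m. pow p (max x0 m))"
    unfolding pow_def by (auto simp: continuous_on_eq_continuous_at intro: continuous_at_imp_continuous_at_within)
qed

text \<open>Both measures give a half-open interval the increment of \<open>m powr p\<close> over its part above \<open>x0\<close>, and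
these intervals generate the Borel sets.\<close>

lemma pow_measure_eq_density:
  assumes "0 \<le> x0" "0 < p"
  shows "pow_measure p x0 = density lborel (\<lambda>m. ennreal (p * m powr (p - 1)) * indicator {x0<..} m)"
    (is "?M = density lborel ?d")
proof (rule measure_eqI_generator_eq[where E = "range (\<lambda>(a, b). {a<..b::real})"
      and \<Omega> = UNIV and A = "\<lambda>n. {- real n<..real n}"])
  note Ioc = emeasure_interval_measure_Ioc_eq[OF pow_max_mono[OF assms] pow_max_right_cont[OF assms]]
  show "Int_stable (range (\<lambda>(a, b). {a<..b::real}))"
    by (auto simp: Int_stable_def)
  show "(\<Union>n. {- real n<..real n}) = UNIV"
  proof safe
    fix x :: real
    obtain n :: nat where "\<bar>x\<bar> < n" using reals_Archimedean2 by blast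
    then show "x \<in> (\<Union>n. {- real n<..real n})" by (intro UN_I[of n]) auto
  qed auto
  show "emeasure ?M {- real n<..real n} \<noteq> \<infinity>" for n
    by (simp add: Ioc)
  fix S assume "S \<in> range (\<lambda>(a, b). {a<..b::real})"
  then obtain a b where S: "S = {a<..b}" by auto
  show "emeasure ?M S = emeasure (density lborel ?d) S"
  proof (cases "a \<le> b")
    case True
    have "emeasure (density lborel ?d) S = (\<integral>\<^sup>+m. ?d m * indicator S m \<partial>lborel)"
      by (subst emeasure_density) (auto simp: S)
    also have "\<dots> = (\<integral>\<^sup>+m. ennreal (p * m powr (p - 1)) * indicator {max x0 a<..<max x0 b} m \<partial>lborel)"
      by (intro nn_integral_cong_AE, use AE_lborel_singleton[of b] in eventually_elim)
         (auto simp: S indicator_def)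
    also have "\<dots> = ennreal (max x0 b powr p - max x0 a powr p)"
      using assms True by (intro nn_integral_powr_deriv) auto
    finally show ?thesis
      using True Ioc[of a b] by (simp add: S) (simp add: pow_def)
  qed (simp add: S)
qed (auto simp: borel_sigma_sets_Ioc image_def split: prod.split)

lemma nn_integral_pow_measure:
  assumes "0 \<le> x0" "0 < p" and [measurable]: "f \<in> borel_measurable borel"
  shows "(\<integral>\<^sup>+m\<in>{x0<..}. f m \<partial>pow_measure p x0)
    = (\<integral>\<^sup>+m. f m * ennreal (p * m powr (p - 1)) * indicator {x0<..} m \<partial>lborel)"
  unfolding pow_measure_eq_density[OF assms(1,2)]
  by (subst nn_integral_density) (auto intro!: nn_integral_cong simp: indicator_def mult_ac)

text \<open>The layer cake formula, pathwise. It is applied to a running maximum to prove the maximal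
inequality in \<open>L\<^sup>p\<close>, and to a heavy-tailed variable to compute its moments.\<close>

lemma pow_eq_nn_integral_pow_measure:
  assumes "0 \<le> x0" "0 < p" "x0 \<le> R"
  shows "ennreal (R powr p) = ennreal (x0 powr p) + (\<integral>\<^sup>+m\<in>{x0<..}. indicator {..<R} m \<partial>pow_measure p x0)"
proof -
  have "(\<integral>\<^sup>+m\<in>{x0<..}. indicator {..<R} m \<partial>pow_measure p x0)
      = (\<integral>\<^sup>+m. ennreal (p * m powr (p - 1)) * indicator {x0<..<R} m \<partial>lborel)"
    using assms by (subst nn_integral_pow_measure) (auto intro!: nn_integral_cong simp: indicator_def)
  also have "\<dots> = ennreal (R powr p - x0 powr p)"
    using assms by (rule_tac nn_integral_powr_deriv) auto
  finally show ?thesis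
    using assms by (simp add: ennreal_plus[symmetric] powr_mono2 del: ennreal_plus)
qed

section \<open>The integrated stop-loss payoff\<close>

text \<open>The function \<open>y \<mapsto> (p / (p - 1))\<^sup>p y\<^sup>p\<close> minus its tangent at \<open>y = (p - 1) / p * x0\<close>.\<close>

definition tangent_gap :: "real \<Rightarrow> real \<Rightarrow> real \<Rightarrow> real" where
  "tangent_gap p x0 y =
     (p / (p - 1)) powr p * y powr p - p\<^sup>2 / (p - 1) * x0 powr (p - 1) * y + (p - 1) * x0 powr p"

text \<open>Bernoulli's inequality for a real exponent: \<open>z powr p - p * z\<close> decreases up to \<open>1\<close> and increases
afterwards.\<close>

lemma powr_gt_tangent_at_1:
  fixes p z :: real
  assumes "1 < p" "0 \<le> z" "z \<noteq> 1"
  shows "1 + p * (z - 1) < z powr p"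
proof -
  let ?h = "\<lambda>z. z powr p - p * z"
  have d: "(?h has_real_derivative p * x powr (p - 1) - p) (at x)" if "0 < x" for x
    using that by (auto intro!: derivative_eq_intros)
  have c: "continuous_on {a..b} ?h" if "0 \<le> a" for a b
    using assms that by (intro continuous_intros continuous_on_powr_nonneg) auto
  have "?h 1 < ?h z"
  proof (cases "z < 1")
    case True
    show ?thesis
    proof (rule DERIV_neg_imp_decreasing_open[OF True _ c])
      fix x assume x: "z < x" "x < 1"
      have "x powr (p - 1) < 1" using x assms powr_less_mono2[of "p - 1" x 1] by simp
      then have "p * x powr (p - 1) - p < 0" using assms by (simp add: algebra_simps)
      then show "\<exists>y. (?h has_real_derivative y) (at x) \<and> y < 0"
        using d[of x] x assms by force
    qed (use assms in auto)
  next
    case False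
    then have z: "1 < z" using assms by auto
    show ?thesis
    proof (rule DERIV_pos_imp_increasing_open[OF z _ c])
      fix x assume x: "1 < x" "x < z"
      have "1 < x powr (p - 1)" using x assms powr_less_mono2[of "p - 1" 1 x] by simp
      then have "0 < p * x powr (p - 1) - p" using assms by simp
      then show "\<exists>y. (?h has_real_derivative y) (at x) \<and> 0 < y"
        using d[of x] x assms by force
    qed auto
  qed
  then show ?thesis by (simp add: algebra_simps)
qed

text \<open>Rescaling by the point of tangency, \<open>z = y / ((p - 1) / p * x0)\<close>, makes this the tangent
inequality at \<open>1\<close>, multiplied by \<open>x0 powr p\<close>.\<close>

lemma tangent_gap_pos:
  assumes "1 < p" "0 < x0" "0 \<le> y" "y \<noteq> (p - 1) / p * x0"
  shows "0 < tangent_gap p x0 y"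
proof -
  define z where "z = y / ((p - 1) / p * x0)"
  have y: "y = (p - 1) / p * x0 * z" using assms by (simp add: z_def)
  have z: "0 \<le> z" "z \<noteq> 1" using assms by (auto simp: z_def)
  have "(p / (p - 1)) powr p * y powr p = (p / (p - 1) * y) powr p"
    using assms by (intro powr_mult[symmetric])
  also have "p / (p - 1) * y = x0 * z"
    using assms by (simp add: y)
  also have "(x0 * z) powr p = x0 powr p * z powr p"
    using assms z by (simp add: powr_mult)
  finally have pw: "(p / (p - 1)) powr p * y powr p = x0 powr p * z powr p" .
  have "p\<^sup>2 / (p - 1) * x0 powr (p - 1) * y = p * z * (x0 powr (p - 1) * x0)"
    unfolding y using assms by (simp add: power2_eq_square)
  also have "x0 powr (p - 1) * x0 = x0 powr p"
    using assms by (simp add: powr_pred_mult)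
  finally have "p\<^sup>2 / (p - 1) * x0 powr (p - 1) * y = p * z * x0 powr p" .
  then have "tangent_gap p x0 y = x0 powr p * (z powr p - (1 + p * (z - 1)))"
    unfolding tangent_gap_def pw by (simp add: algebra_simps)
  then show ?thesis
    using powr_gt_tangent_at_1[of p z] assms z by simp
qed

lemma tangent_gap_eq_0:
  assumes "1 < p" "0 \<le> x0" 
  shows "tangent_gap p x0 ((p - 1) / p * x0) = 0"
proof -
  define y where "y = (p - 1) / p * x0"
  have "(p / (p - 1)) powr p * y powr p = (p / (p - 1) * y) powr p"
    using assms by (intro powr_mult[symmetric])
  also have "p / (p - 1) * y = x0"
    using assms by (simp add: y_def)
  finally have pw: "(p / (p - 1)) powr p * y powr p = x0 powr p" .
  have "p\<^sup>2 / (p - 1) * x0 powr (p - 1) * y = p * (x0 powr (p - 1) * x0)"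
    using assms by (simp add: power2_eq_square y_def)
  also have "x0 powr (p - 1) * x0 = x0 powr p"
    using assms by (simp add: powr_pred_mult)
  finally show ?thesis
    unfolding tangent_gap_def y_def[symmetric] pw by (simp add: algebra_simps)
qed

lemma tangent_gap_nonneg:
  assumes "1 < p" "0 \<le> x0" "0 \<le> y"
  shows "0 \<le> tangent_gap p x0 y"
proof (cases "x0 = 0")
  case False
  then show ?thesis
    using tangent_gap_pos[of p x0 y] tangent_gap_eq_0[of p x0] assms by force
qed (use assms in \<open>simp add: tangent_gap_def\<close>)

text \<open>The denominator is \<open>m / p\<close>, so the integrand against Lebesgue measure is
\<open>p\<^sup>2 (y - \<alpha> m) m powr (p - 2)\<close> on \<open>x0 < m < y / \<alpha>\<close>, which has an elementary antiderivative. Its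
value at \<open>y / \<alpha>\<close> is the power term of the gap and its value at \<open>x0\<close> is the tangent.\<close>

lemma nn_integral_stop_loss_pow_measure:
  assumes "1 < p" "0 \<le> x0" "0 \<le> y"
  defines "\<alpha> \<equiv> (p - 1) / p"
  shows "(\<integral>\<^sup>+m\<in>{x0<..}. ennreal (max 0 (y - zeta \<alpha> m) / (m - zeta \<alpha> m)) \<partial>pow_measure p x0)
    = ennreal (if \<alpha> * x0 \<le> y then tangent_gap p x0 y else 0)"
proof -
  have \<alpha>: "0 < \<alpha>" "\<alpha> < 1" and p\<alpha>: "1 - \<alpha> = 1 / p"
    using assms by (auto simp: \<alpha>_def field_simps)
  have "(\<integral>\<^sup>+m\<in>{x0<..}. ennreal (max 0 (y - zeta \<alpha> m) / (m - zeta \<alpha> m)) \<partial>pow_measure p x0)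
      = (\<integral>\<^sup>+m. ennreal (p\<^sup>2 * (y - \<alpha> * m) * m powr (p - 2)) * indicator {x0<..<y / \<alpha>} m \<partial>lborel)"
  proof (subst nn_integral_pow_measure)
    show "(\<integral>\<^sup>+m. ennreal (max 0 (y - zeta \<alpha> m) / (m - zeta \<alpha> m)) * ennreal (p * m powr (p - 1))
          * indicator {x0<..} m \<partial>lborel)
      = (\<integral>\<^sup>+m. ennreal (p\<^sup>2 * (y - \<alpha> * m) * m powr (p - 2)) * indicator {x0<..<y / \<alpha>} m \<partial>lborel)"
    proof (intro nn_integral_cong)
      fix m :: real
      have "ennreal (max 0 (y - \<alpha> * m) / (m - \<alpha> * m)) * ennreal (p * m powr (p - 1))
          = ennreal (p\<^sup>2 * (y - \<alpha> * m) * m powr (p - 2))" if m: "x0 < m" "m < y / \<alpha>"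
      proof -
        have "m > 0" using m assms by auto
        have y: "0 \<le> y - \<alpha> * m" using m \<alpha> by (simp add: field_simps)
        have "m - \<alpha> * m = m / p" using p\<alpha> by (metis mult.commute mult.right_neutral right_diff_distrib' times_divide_eq_right)
        moreover have "m powr (p - 1) = m powr (p - 2) * m"
          using \<open>m > 0\<close> powr_add[of m "p - 2" 1] by simp
        ultimately have "max 0 (y - \<alpha> * m) / (m - \<alpha> * m) * (p * m powr (p - 1))
            = p\<^sup>2 * (y - \<alpha> * m) * m powr (p - 2)"
          using y assms \<open>m > 0\<close> by (simp add: power2_eq_square)
        then show ?thesis
          using y \<open>1 < p\<close> \<open>m > 0\<close> \<open>m - \<alpha> * m = m / p\<close> by (metis abs_ge_zero abs_of_nonneg divide_nonneg_pos ennreal_mult less_eq_real_def max.cobounded1 mult_nonneg_nonneg powr_ge_zero divide_pos_pos order.strict_trans zero_less_one)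
      qed
      moreover have "max 0 (y - \<alpha> * m) = 0" if "\<not> m < y / \<alpha>"
        using that \<alpha> by (auto simp: field_simps)
      ultimately show "ennreal (max 0 (y - zeta \<alpha> m) / (m - zeta \<alpha> m)) * ennreal (p * m powr (p - 1))
          * indicator {x0<..} m = ennreal (p\<^sup>2 * (y - \<alpha> * m) * m powr (p - 2)) * indicator {x0<..<y / \<alpha>} m"
        by (auto simp: indicator_def zeta_def)
    qed
  qed (use assms in \<open>auto simp: zeta_def\<close>)
  also have "\<dots> = ennreal (if \<alpha> * x0 \<le> y then tangent_gap p x0 y else 0)"
  proof (cases "\<alpha> * x0 \<le> y")
    case False
    then have "{x0<..<y / \<alpha>} = {}" using \<alpha> by (auto simp: field_simps)
    with False show ?thesis by simp
  next
    case True
    define H where "H m = p\<^sup>2 * (y / (p - 1) * m powr (p - 1) - \<alpha> / p * m powr p)" for m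
    have "(\<integral>\<^sup>+m. ennreal (p\<^sup>2 * (y - \<alpha> * m) * m powr (p - 2)) * indicator {x0<..<y / \<alpha>} m \<partial>lborel)
        = ennreal (H (y / \<alpha>) - H x0)"
    proof (rule nn_integral_FTC_open)
      show "x0 \<le> y / \<alpha>" using True \<alpha> by (simp add: field_simps)
      show "continuous_on {x0..y / \<alpha>} H"
        unfolding H_def using assms by (intro continuous_intros continuous_on_powr_nonneg) auto
      fix m assume m: "x0 < m" "m < y / \<alpha>"
      then have "m > 0" using assms by auto
      have *: "m powr (p - 1) = m powr (p - 2) * m"
          using \<open>m > 0\<close> powr_add[of m "p - 2" 1] by simp
      have "(H has_real_derivative
          p\<^sup>2 * (y / (p - 1) * ((p - 1) * m powr (p - 1 - 1)) - \<alpha> / p * (p * m powr (p - 1)))) (at m)"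
        unfolding H_def using \<open>m > 0\<close> \<open>1 < p\<close> by (auto intro!: derivative_eq_intros)
      also have "y / (p - 1) * ((p - 1) * m powr (p - 1 - 1)) - \<alpha> / p * (p * m powr (p - 1))
          = (y - \<alpha> * m) * m powr (p - 2)"
        using \<open>1 < p\<close> by (simp add: *) (simp add: algebra_simps)
      finally show "(H has_real_derivative p\<^sup>2 * (y - \<alpha> * m) * m powr (p - 2)) (at m)"
        by (simp add: mult.assoc)
      show "0 \<le> p\<^sup>2 * (y - \<alpha> * m) * m powr (p - 2)"
        using m \<alpha> by (intro mult_nonneg_nonneg) (auto simp: field_simps)
    qed
    also have "H (y / \<alpha>) - H x0 = tangent_gap p x0 y"
    proof -
      have y_part: "y * (y / \<alpha>) powr (p - 1) = \<alpha> * (y / \<alpha>) powr p"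
        using powr_pred_mult[of "y / \<alpha>" p] \<open>0 \<le> y\<close> \<alpha> by (simp add: field_simps)
      have "H (y / \<alpha>) = p\<^sup>2 / (p - 1) * (y * (y / \<alpha>) powr (p - 1)) - p * \<alpha> * (y / \<alpha>) powr p"
        using \<open>1 < p\<close> by (simp add: H_def power2_eq_square algebra_simps)
      also have "\<dots> = (p\<^sup>2 / (p - 1) * \<alpha> - p * \<alpha>) * (y / \<alpha>) powr p"
        unfolding y_part by (simp add: algebra_simps)
      also have "p\<^sup>2 / (p - 1) * \<alpha> - p * \<alpha> = 1"
        using \<open>1 < p\<close> by (simp add: \<alpha>_def power2_eq_square)
      also have "(y / \<alpha>) powr p = (p / (p - 1) * y) powr p"
        by (simp add: \<alpha>_def mult.commute)
      also have "\<dots> = (p / (p - 1)) powr p * y powr p"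
        by (rule powr_mult)
      finally have upper: "H (y / \<alpha>) = (p / (p - 1)) powr p * y powr p"
        by simp
      have "H x0 = p\<^sup>2 / (p - 1) * x0 powr (p - 1) * y - p * \<alpha> * x0 powr p"
        using \<open>1 < p\<close> by (simp add: H_def power2_eq_square algebra_simps)
      also have "p * \<alpha> = p - 1"
        using \<open>1 < p\<close> by (simp add: \<alpha>_def)
      finally show ?thesis
        by (simp add: upper tangent_gap_def)
    qed
    finally show ?thesis using True by simp
  qed
  finally show ?thesis .
qed

section \<open>Natural filtrations and submartingales\<close>

context prob_space
begin

lemma space_natural_filtration [simp]: "space (natural_filtration M X t) = space M"
  by (simp add: natural_filtration_def space_measure_of_conv)

lemma sets_natural_filtration:
  "sets (natural_filtration M X t) =
    sigma_sets (space M) {X s -` A \<inter> space M | s A. s \<in> {0..t} \<and> A \<in> sets borel}"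
  unfolding natural_filtration_def by (rule sets_measure_of) auto

lemma measurable_natural_filtration:
  assumes "0 \<le> s" "s \<le> t"
  shows "X s \<in> borel_measurable (natural_filtration M X t)"
  by (rule measurableI) (use assms in \<open>auto simp: sets_natural_filtration intro!: sigma_sets.Basic\<close>)

lemma sets_natural_filtration_mono:
  assumes "s \<le> t"
  shows "sets (natural_filtration M X s) \<subseteq> sets (natural_filtration M X t)"
  unfolding sets_natural_filtration using assms by (intro sigma_sets_mono') fastforce

lemma sigma_finite_subalgebra_natural_filtration:
  assumes "\<And>s. 0 \<le> s \<Longrightarrow> s \<le> t \<Longrightarrow> X s \<in> borel_measurable M"
  shows "sigma_finite_subalgebra M (natural_filtration M X t)"
proof -
  have "subalgebra M (natural_filtration M X t)"
    unfolding subalgebra_def sets_natural_filtration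
    using assms by (auto intro!: sets.sigma_sets_subset measurable_sets)
  then show ?thesis
    by (intro finite_measure_subalgebra_is_sigma_finite)
       (auto simp: finite_measure_subalgebra_def finite_measure_subalgebra_axioms_def finite_measure_axioms)
qed

lemma submartingale_integrable:
  assumes "submartingale M T X" "0 \<le> t" "t \<le> T"
  shows "integrable M (X t)"
  using assms by (auto simp: submartingale_def submartingale_wrt_def)

lemma submartingale_sigma_finite_subalgebra:
  assumes "submartingale M T X" "t \<le> T"
  shows "sigma_finite_subalgebra M (natural_filtration M X t)"
  using submartingale_integrable[OF assms(1)] assms(2)
  by (intro sigma_finite_subalgebra_natural_filtration) auto

lemma submartingale_set_integral_mono:
  assumes X: "submartingale M T X" and st: "0 \<le> s" "s \<le> t" "t \<le> T"
    and A: "A \<in> sets (natural_filtration M X s)"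
  shows "(\<integral>\<omega>\<in>A. X s \<omega> \<partial>M) \<le> (\<integral>\<omega>\<in>A. X t \<omega> \<partial>M)"
proof -
  interpret F: sigma_finite_subalgebra M "natural_filtration M X s"
    using submartingale_sigma_finite_subalgebra[OF X] st by simp
  have AM: "A \<in> sets M" using A F.subalg by (auto simp: subalgebra_def)
  have X_int: "integrable M (X s)" "integrable M (X t)"
    using submartingale_integrable[OF X] st by auto
  have "(\<integral>\<omega>\<in>A. X s \<omega> \<partial>M) \<le> (\<integral>\<omega>\<in>A. real_cond_exp M (natural_filtration M X s) (X t) \<omega> \<partial>M)"
  proof (rule set_integral_mono_AE)
    have "AE \<omega> in M. X s \<omega> \<le> real_cond_exp M (natural_filtration M X s) (X t) \<omega>"
      using X st unfolding submartingale_def submartingale_wrt_def by blast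
    then show "AE \<omega>\<in>A in M. X s \<omega> \<le> real_cond_exp M (natural_filtration M X s) (X t) \<omega>"
      by eventually_elim auto
  qed (use AM X_int F.real_cond_exp_int(1)[OF X_int(2)] in \<open>simp_all add: set_integrable_def integrable_mult_indicator del: real_scaleR_def\<close>)
  also have "\<dots> = (\<integral>\<omega>\<in>A. X t \<omega> \<partial>M)"
    using F.real_cond_exp_intA[OF X_int(2) A] by simp
  finally show ?thesis .
qed

section \<open>Doob's maximal inequality\<close>

text \<open>Split the event according to the first time \<open>s\<close> at which \<open>X\<close> exceeds \<open>m\<close>. Each piece \<open>A s\<close> is known
at time \<open>s\<close>, so replacing \<open>X s\<close> by \<open>X T\<close> does not decrease the integral over \<open>A s\<close>; the
pieces are disjoint, so the resulting integrals of \<open>X T - c\<close> add up to at most that of its positive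
part. Working with \<open>X\<close> itself avoids showing that \<open>(X - c)\<^sup>+\<close> is a submartingale.\<close>

lemma submartingale_maximal_ineq_finite:
  assumes X: "submartingale M T X" and S: "finite S" "S \<subseteq> {0..T}" and "0 \<le> T"
  shows "(m - c) * prob {\<omega> \<in> space M. \<exists>s\<in>S. m < X s \<omega>} \<le> (\<integral>\<omega>. max 0 (X T \<omega> - c) \<partial>M)"
proof -
  define A where "A s = {\<omega> \<in> space M. m < X s \<omega> \<and> (\<forall>r\<in>S. r < s \<longrightarrow> X r \<omega> \<le> m)}" for s
  have A_F: "A s \<in> sets (natural_filtration M X s)" if "s \<in> S" for s
  proof -
    have [measurable]: "X r \<in> borel_measurable (natural_filtration M X s)" if "r \<in> {r \<in> S. r \<le> s}" for r
      using that S by (intro measurable_natural_filtration) auto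
    have "A s = {\<omega> \<in> space (natural_filtration M X s). m < X s \<omega> \<and> (\<forall>r\<in>{r\<in>S. r < s}. X r \<omega> \<le> m)}"
      by (auto simp: A_def)
    also have "\<dots> \<in> sets (natural_filtration M X s)"
      using that S(1) by (intro sets.sets_Collect sets.sets_Collect_finite_All borel_measurable_less borel_measurable_le) measurable
    finally show ?thesis .
  qed
  have A_M [measurable]: "A s \<in> sets M" if "s \<in> S" for s
  proof -
    have sT: "s \<le> T" using that S(2) by auto
    show ?thesis
    using A_F[OF that] submartingale_sigma_finite_subalgebra[OF X sT]
    unfolding sigma_finite_subalgebra_def subalgebra_def by auto
  qed
  have disj: "disjoint_family_on A S"
    unfolding disjoint_family_on_def
  proof safe
    fix s r \<omega> assume "s \<in> S" "r \<in> S" "s \<noteq> r" "\<omega> \<in> A s" "\<omega> \<in> A r"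
    then show "\<omega> \<in> {}"
      by (cases s r rule: linorder_cases) (force simp: A_def)+
  qed
  have Un: "(\<Union>s\<in>S. A s) = {\<omega> \<in> space M. \<exists>s\<in>S. m < X s \<omega>}"
  proof safe
    fix \<omega> s assume *: "\<omega> \<in> space M" "s \<in> S" "m < X s \<omega>"
    define s0 where "s0 = Min {s\<in>S. m < X s \<omega>}"
    have "s0 \<in> {s\<in>S. m < X s \<omega>}"
      unfolding s0_def using * S by (intro Min_in) auto
    moreover have "X r \<omega> \<le> m" if "r \<in> S" "r < s0" for r
    proof (rule ccontr)
      assume "\<not> X r \<omega> \<le> m"
      then have "s0 \<le> r" unfolding s0_def using that S by (intro Min_le) auto
      with that show False by simp
    qed
    ultimately show "\<omega> \<in> (\<Union>s\<in>S. A s)" using * by (auto simp: A_def)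
  qed (auto simp: A_def)
  have int: "integrable M (X s)" if "s \<in> insert T S" for s
    using that S \<open>0 \<le> T\<close> by (intro submartingale_integrable[OF X]) auto
  have XT: "integrable M (X T)" by (rule int) simp
  have "(m - c) * prob {\<omega> \<in> space M. \<exists>s\<in>S. m < X s \<omega>} = (\<Sum>s\<in>S. (m - c) * prob (A s))"
    unfolding Un[symmetric] using S disj by (subst finite_measure_finite_Union) (auto simp: sum_distrib_left)
  also have "\<dots> \<le> (\<Sum>s\<in>S. (\<integral>\<omega>\<in>A s. X T \<omega> - c \<partial>M))"
  proof (rule sum_mono)
    fix s assume s: "s \<in> S"
    have [simp]: "set_integrable M (A s) (X r)" if "r \<in> insert T S" for r
      unfolding set_integrable_def using int that s by (intro integrable_mult_indicator) auto
    have [simp]: "set_integrable M (A s) (\<lambda>_. b)" for b :: real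
      unfolding set_integrable_def using s by (intro integrable_mult_indicator) auto
    have const: "(\<integral>\<omega>\<in>A s. b \<partial>M) = b * prob (A s)" for b :: real
      using s by (simp add: set_lebesgue_integral_def)
    have above: "m - c \<le> X s \<omega> - c" if "\<omega> \<in> A s" for \<omega>
      using that by (simp add: A_def)
    have "(m - c) * prob (A s) = (\<integral>\<omega>\<in>A s. m - c \<partial>M)"
      by (simp add: const)
    also have "\<dots> \<le> (\<integral>\<omega>\<in>A s. X s \<omega> - c \<partial>M)"
      using s by (intro set_integral_mono set_integral_diff above) auto
    also have "\<dots> = (\<integral>\<omega>\<in>A s. X s \<omega> \<partial>M) - c * prob (A s)"
      using s by (simp add: const)
    also have "\<dots> \<le> (\<integral>\<omega>\<in>A s. X T \<omega> \<partial>M) - c * prob (A s)"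
      using submartingale_set_integral_mono[OF X _ _ _ A_F[OF s], of T] s S by auto
    also have "\<dots> = (\<integral>\<omega>\<in>A s. X T \<omega> - c \<partial>M)"
      using s by (simp add: const)
    finally show "(m - c) * prob (A s) \<le> (\<integral>\<omega>\<in>A s. X T \<omega> - c \<partial>M)" .
  qed
  also have "\<dots> = (\<integral>\<omega>. (\<Sum>s\<in>S. indicator (A s) \<omega> * (X T \<omega> - c)) \<partial>M)"
  proof (subst Bochner_Integration.integral_sum)
    show "integrable M (\<lambda>\<omega>. indicator (A s) \<omega> * (X T \<omega> - c))" if "s \<in> S" for s
      using that XT integrable_mult_indicator[of "A s" M "\<lambda>\<omega>. X T \<omega> - c"] by simp
  qed (simp add: set_lebesgue_integral_def)
  also have "\<dots> \<le> (\<integral>\<omega>. max 0 (X T \<omega> - c) \<partial>M)"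
  proof (rule integral_mono)
    show "integrable M (\<lambda>\<omega>. \<Sum>s\<in>S. indicator (A s) \<omega> * (X T \<omega> - c))"
      using XT integrable_mult_indicator[of _ M "\<lambda>\<omega>. X T \<omega> - c"] by (intro Bochner_Integration.integrable_sum) auto
    show "integrable M (\<lambda>\<omega>. max 0 (X T \<omega> - c))"
      using XT by (intro integrable_max) auto
    fix \<omega>
    have "(\<Sum>s\<in>S. indicator (A s) \<omega>) = (indicator (\<Union>s\<in>S. A s) \<omega> :: real)"
      by (rule indicator_UN_disjoint[OF S(1) disj, symmetric])
    then have "(\<Sum>s\<in>S. indicator (A s) \<omega> * (X T \<omega> - c)) = indicator (\<Union>s\<in>S. A s) \<omega> * (X T \<omega> - c)"
      by (simp add: sum_distrib_right[symmetric])
    also have "\<dots> \<le> max 0 (X T \<omega> - c)" by (simp add: indicator_def)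
    finally show "(\<Sum>s\<in>S. indicator (A s) \<omega> * (X T \<omega> - c)) \<le> max 0 (X T \<omega> - c)" .
  qed
  finally show ?thesis .
qed

lemma submartingale_maximal_ineq_sequence:
  fixes d :: "nat \<Rightarrow> real"
  assumes X: "submartingale M T X" and d: "range d \<subseteq> {0..T}" and "c < m"
  shows "emeasure M {\<omega> \<in> space M. \<exists>n. m < X (d n) \<omega>}
    \<le> (\<integral>\<^sup>+\<omega>. ennreal (max 0 (X T \<omega> - c) / (m - c)) \<partial>M)"
proof -
  have "0 \<le> T" using d by (metis atLeastAtMost_iff order_trans range_subsetD)
  have int: "integrable M (X t)" if "t \<in> {0..T}" for t
    using that by (intro submartingale_integrable[OF X]) auto
  have [measurable]: "X (d n) \<in> borel_measurable M" for n
    using int[of "d n"] d by (meson borel_measurable_integrable range_subsetD)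
  define E where "E n = {\<omega> \<in> space M. \<exists>s\<in>d ` {..n}. m < X s \<omega>}" for n :: nat
  have [measurable]: "E n \<in> sets M" for n unfolding E_def by simp
  have "(\<lambda>n. prob (E n)) \<longlonglongrightarrow> prob (\<Union>n. E n)"
    by (intro finite_Lim_measure_incseq) (auto simp: incseq_def E_def)
  moreover have "prob (E n) \<le> (\<integral>\<omega>. max 0 (X T \<omega> - c) \<partial>M) / (m - c)" for n
    using submartingale_maximal_ineq_finite[OF X, of "d ` {..n}" m c] d \<open>0 \<le> T\<close> \<open>c < m\<close>
    by (auto simp: E_def field_simps)
  ultimately have "prob (\<Union>n. E n) \<le> (\<integral>\<omega>. max 0 (X T \<omega> - c) \<partial>M) / (m - c)"
    by (intro LIMSEQ_le_const2) auto
  also have "(\<Union>n. E n) = {\<omega> \<in> space M. \<exists>n. m < X (d n) \<omega>}"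
    by (auto simp: E_def)
  finally have "ennreal (prob {\<omega> \<in> space M. \<exists>n. m < X (d n) \<omega>})
      \<le> ennreal (\<integral>\<omega>. max 0 (X T \<omega> - c) / (m - c) \<partial>M)"
    by (intro ennreal_leI) simp
  also have "\<dots> = (\<integral>\<^sup>+\<omega>. ennreal (max 0 (X T \<omega> - c) / (m - c)) \<partial>M)"
    using int[of T] \<open>0 \<le> T\<close> \<open>c < m\<close>
    by (intro nn_integral_eq_integral[symmetric] integrable_divide integrable_max) auto
  finally show ?thesis by (simp add: emeasure_eq_measure)
qed

end

section \<open>Running maxima of cadlag paths\<close>

definition cadlag_path :: "real \<Rightarrow> (real \<Rightarrow> real) \<Rightarrow> bool" where
  "cadlag_path T f \<longleftrightarrow>
     (\<forall>t\<in>{0..<T}. continuous (at_right t) f) \<and> (\<forall>t\<in>{0<..T}. \<exists>l. (f \<longlongrightarrow> l) (at_left t))"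

text \<open>One-sided limits bound the path near every point, and finitely many such neighbourhoods cover
the compact interval. Without boundedness the supremum of real numbers defining the running maximum
would carry no information.\<close>

lemma cadlag_path_bdd_above:
  assumes f: "cadlag_path T f"
  shows "bdd_above (f ` {0..T})"
proof -
  have "\<exists>U K. open U \<and> t \<in> U \<and> (\<forall>s\<in>U \<inter> {0..T}. f s \<le> K)" if t: "t \<in> {0..T}" for t
  proof -
    have "\<exists>K. eventually (\<lambda>s. s \<in> {0..T} \<longrightarrow> f s \<le> K) (at_left t)"
    proof (cases "t = 0")
      case True
      then show ?thesis by (auto simp: eventually_at_filter)
    next
      case False
      then obtain l where "(f \<longlongrightarrow> l) (at_left t)"
        using f t unfolding cadlag_path_def by (metis atLeastAtMost_iff greaterThanAtMost_iff le_less)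
      then have "eventually (\<lambda>s. f s < l + 1) (at_left t)" by (rule order_tendstoD) simp
      then show ?thesis by (auto elim!: eventually_mono intro!: exI[of _ "l + 1"])
    qed
    then obtain K1 where K1: "eventually (\<lambda>s. s \<in> {0..T} \<longrightarrow> f s \<le> K1) (at_left t)" ..
    have "\<exists>K. eventually (\<lambda>s. s \<in> {0..T} \<longrightarrow> f s \<le> K) (at_right t)"
    proof (cases "t = T")
      case True
      then show ?thesis by (auto simp: eventually_at_filter)
    next
      case False
      then have "(f \<longlongrightarrow> f t) (at_right t)" using f t by (auto simp: cadlag_path_def continuous_within)
      then have "eventually (\<lambda>s. f s < f t + 1) (at_right t)" by (rule order_tendstoD) simp
      then show ?thesis by (auto elim!: eventually_mono intro!: exI[of _ "f t + 1"])
    qed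
    then obtain K2 where K2: "eventually (\<lambda>s. s \<in> {0..T} \<longrightarrow> f s \<le> K2) (at_right t)" ..
    \<comment> \<open>\<open>K1\<close> and \<open>K2\<close> bound the path in punctured neighbourhoods only, so its value at \<open>t\<close> enters too.\<close>
    define K where "K = max (f t) (max K1 K2)"
    have "eventually (\<lambda>s. s \<in> {0..T} \<longrightarrow> f s \<le> K) (at t)"
      unfolding eventually_at_split
      using K1 K2 by (auto elim!: eventually_mono simp: K_def)
    then obtain U where U: "open U" "t \<in> U" "\<And>s. s \<in> U \<Longrightarrow> s \<noteq> t \<Longrightarrow> s \<in> {0..T} \<longrightarrow> f s \<le> K"
      by (auto simp: eventually_at_topological)
    have "f s \<le> K" if "s \<in> U \<inter> {0..T}" for s
      using that U(3)[of s] by (cases "s = t") (auto simp: K_def)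
    with U show ?thesis by blast
  qed
  then obtain U K where U: "\<And>t. t \<in> {0..T} \<Longrightarrow> open (U t) \<and> t \<in> U t \<and> (\<forall>s\<in>U t \<inter> {0..T}. f s \<le> K t)"
    by metis
  obtain C where C: "C \<subseteq> {0..T}" "finite C" "{0..T} \<subseteq> (\<Union>t\<in>C. U t)"
    by (rule compactE_image[OF compact_Icc, of "{0..T}" U 0 T]) (use U in auto)
  show ?thesis
  proof (rule bdd_aboveI2)
    fix s assume s: "s \<in> {0..T}"
    then obtain t where t: "t \<in> C" "s \<in> U t" using C by auto
    then have "f s \<le> K t" using U[of t] C s by auto
    also have "K t \<le> Max (K ` C)" using t C by (intro Max_ge) auto
    finally show "f s \<le> Max (K ` C)" .
  qed
qed

text \<open>By right-continuity, a level exceeded at a time before \<open>T\<close> is also exceeded at a rational time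
shortly afterwards; only \<open>T\<close> itself has to be added to the rationals. The sequence does not
depend on the path, which makes the event that the maximum exceeds \<open>m\<close> a countable union.\<close>

lemma cadlag_path_exceeds_on_dense_sequence:
  assumes "0 < T"
  obtains d :: "nat \<Rightarrow> real" where "range d \<subseteq> {0..T}"
    "\<And>f t m. cadlag_path T f \<Longrightarrow> t \<in> {0..T} \<Longrightarrow> m < f t \<Longrightarrow> \<exists>n. m < f (d n)"
proof
  define D where "D = insert T (\<rat> \<inter> {0..T})"
  have D: "range (from_nat_into D) = D"
    by (intro range_from_nat_into) (auto simp: D_def countable_rat)
  show "range (from_nat_into D) \<subseteq> {0..T}"
    unfolding D using assms by (auto simp: D_def)
  fix f t m assume f: "cadlag_path T f" and t: "t \<in> {0..T}" and m: "m < f t"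
  have "\<exists>s\<in>D. m < f s"
  proof (cases "t = T")
    case False
    then have "t < T" using t by auto
    have "(f \<longlongrightarrow> f t) (at_right t)"
      using f t False by (auto simp: cadlag_path_def continuous_within)
    then have "eventually (\<lambda>s. m < f s) (at_right t)" using m by (rule order_tendstoD)
    then obtain b where b: "t < b" "\<And>s. t < s \<Longrightarrow> s < b \<Longrightarrow> m < f s"
      by (auto simp: eventually_at_right_field)
    obtain q where "q \<in> \<rat>" "t < q" "q < min b T"
      using Rats_dense_in_real[of t "min b T"] b \<open>t < T\<close> by auto
    moreover have "m < f q" using b(2)[of q] calculation by auto
    moreover have "q \<in> D" using calculation t by (auto simp: D_def)
    ultimately show ?thesis by blast
  qed (use m in \<open>auto simp: D_def\<close>)
  then show "\<exists>n. m < f (from_nat_into D n)"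
    using D by (metis imageE)
qed

lemma cadlag_iff_cadlag_path: "cadlag M T X \<longleftrightarrow> (\<forall>\<omega>\<in>space M. cadlag_path T (\<lambda>t. X t \<omega>))"
  by (simp add: cadlag_def cadlag_path_def)

lemma running_max_upper:
  assumes "cadlag M T X" "\<omega> \<in> space M" "t \<in> {0..T}"
  shows "X t \<omega> \<le> running_max X T \<omega>"
  unfolding running_max_def
  using assms by (intro cSUP_upper cadlag_path_bdd_above) (auto simp: cadlag_iff_cadlag_path)

section \<open>The maximum is bounded by the integrated maximal inequality\<close>

context prob_space
begin

text \<open>Layer cake for the maximum, Fubini, and the maximal inequality with level \<open>c = zeta \<alpha> m\<close> for each
\<open>m\<close>. A maximum below \<open>x0\<close> is covered by
the summand \<open>x0 powr p\<close>.\<close>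

lemma expect_running_max_powr_le_UB:
  assumes nn: "nonneg_process M T X" and cad: "cadlag M T X" and X: "submartingale M T X"
    and "0 < T" "0 \<le> x0" "0 < p" "\<alpha> < 1"
  shows "expect_nonneg M (\<lambda>\<omega>. running_max X T \<omega> powr p) \<le> UB M T x0 X (pow p) (zeta \<alpha>)"
proof -
  let ?\<mu> = "pow_measure p x0"
  obtain d :: "nat \<Rightarrow> real" where d: "range d \<subseteq> {0..T}"
    "\<And>f t m. cadlag_path T f \<Longrightarrow> t \<in> {0..T} \<Longrightarrow> m < f t \<Longrightarrow> \<exists>n. m < f (d n)"
    using cadlag_path_exceeds_on_dense_sequence[OF \<open>0 < T\<close>] by blast
  have [measurable]: "X (d n) \<in> borel_measurable M" for n
    using submartingale_integrable[OF X, of "d n"] d(1)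
    by (meson atLeastAtMost_iff borel_measurable_integrable range_subsetD)
  interpret \<mu>: sigma_finite_measure ?\<mu>
    by (rule sigma_finite_interval_measure[OF pow_max_mono[OF \<open>0 \<le> x0\<close> \<open>0 < p\<close>] pow_max_right_cont[OF \<open>0 \<le> x0\<close> \<open>0 < p\<close>]])
  interpret pair_sigma_finite ?\<mu> M ..
  define E where "E m \<omega> \<longleftrightarrow> (\<exists>n. m < X (d n) \<omega>)" for m \<omega>
  have [measurable]: "(\<lambda>(m, \<omega>). (of_bool (E m \<omega>) :: ennreal) * indicator {x0<..} m) \<in> borel_measurable (?\<mu> \<Otimes>\<^sub>M M)"
    unfolding E_def of_bool_def by measurable
  have pointwise: "ennreal (running_max X T \<omega> powr p)
      \<le> ennreal (x0 powr p) + (\<integral>\<^sup>+m\<in>{x0<..}. of_bool (E m \<omega>) \<partial>?\<mu>)" if \<omega>: "\<omega> \<in> space M" for \<omega>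
  proof (cases "x0 \<le> running_max X T \<omega>")
    case True
    have "(\<integral>\<^sup>+m\<in>{x0<..}. indicator {..<running_max X T \<omega>} m \<partial>?\<mu>) \<le> (\<integral>\<^sup>+m\<in>{x0<..}. of_bool (E m \<omega>) \<partial>?\<mu>)"
    proof (intro nn_integral_mono mult_right_mono)
      fix m
      have "E m \<omega>" if "m < running_max X T \<omega>"
      proof -
        have "\<exists>t\<in>{0..T}. m < X t \<omega>"
          using that \<open>0 < T\<close> unfolding running_max_def
          by (subst less_cSUP_iff[symmetric])
             (use cad \<omega> in \<open>auto simp: cadlag_iff_cadlag_path intro!: cadlag_path_bdd_above\<close>)
        then show ?thesis
          using d(2)[of "\<lambda>t. X t \<omega>"] cad \<omega> by (auto simp: E_def cadlag_iff_cadlag_path)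
      qed
      then show "indicator {..<running_max X T \<omega>} m \<le> (of_bool (E m \<omega>) :: ennreal)"
        by (auto simp: indicator_def)
    qed auto
    then show ?thesis
      using pow_eq_nn_integral_pow_measure[OF \<open>0 \<le> x0\<close> \<open>0 < p\<close> True] by (simp add: add_left_mono)
  next
    case False
    have "0 \<le> X 0 \<omega>" using nn \<omega> \<open>0 < T\<close> by (auto simp: nonneg_process_def)
    also have "\<dots> \<le> running_max X T \<omega>"
      using running_max_upper[OF cad \<omega>, of 0] \<open>0 < T\<close> by auto
    finally have "running_max X T \<omega> powr p \<le> x0 powr p"
      using False \<open>0 < p\<close> by (intro powr_mono2) auto
    then show ?thesis by (intro add_increasing2 ennreal_leI) auto
  qed
  have "(\<integral>\<^sup>+\<omega>. ennreal (running_max X T \<omega> powr p) \<partial>M)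
      \<le> (\<integral>\<^sup>+\<omega>. ennreal (x0 powr p) + (\<integral>\<^sup>+m\<in>{x0<..}. of_bool (E m \<omega>) \<partial>?\<mu>) \<partial>M)"
    by (intro nn_integral_mono pointwise)
  also have "\<dots> = ennreal (x0 powr p) + (\<integral>\<^sup>+\<omega>. (\<integral>\<^sup>+m\<in>{x0<..}. of_bool (E m \<omega>) \<partial>?\<mu>) \<partial>M)"
    by (subst nn_integral_add) (auto simp: emeasure_space_1)
  also have "(\<integral>\<^sup>+\<omega>. (\<integral>\<^sup>+m\<in>{x0<..}. of_bool (E m \<omega>) \<partial>?\<mu>) \<partial>M)
      = (\<integral>\<^sup>+m. (\<integral>\<^sup>+\<omega>. of_bool (E m \<omega>) * indicator {x0<..} m \<partial>M) \<partial>?\<mu>)"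
    by (subst Fubini') auto
  also have "\<dots> \<le> (\<integral>\<^sup>+m\<in>{x0<..}. (\<integral>\<^sup>+\<omega>. ennreal (max 0 (X T \<omega> - zeta \<alpha> m) / (m - zeta \<alpha> m)) \<partial>M) \<partial>?\<mu>)"
  proof (intro nn_integral_mono)
    fix m
    have "(\<integral>\<^sup>+\<omega>. of_bool (E m \<omega>) \<partial>M) \<le> (\<integral>\<^sup>+\<omega>. ennreal (max 0 (X T \<omega> - zeta \<alpha> m) / (m - zeta \<alpha> m)) \<partial>M)"
      if "x0 < m"
    proof -
      have "(\<integral>\<^sup>+\<omega>. of_bool (E m \<omega>) \<partial>M) = (\<integral>\<^sup>+\<omega>. indicator {\<omega> \<in> space M. \<exists>n. m < X (d n) \<omega>} \<omega> \<partial>M)"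
        by (intro nn_integral_cong) (auto simp: E_def indicator_def)
      also have "\<dots> = emeasure M {\<omega> \<in> space M. \<exists>n. m < X (d n) \<omega>}"
        by simp
      also have "\<dots> \<le> (\<integral>\<^sup>+\<omega>. ennreal (max 0 (X T \<omega> - zeta \<alpha> m) / (m - zeta \<alpha> m)) \<partial>M)"
        using that \<open>0 \<le> x0\<close> \<open>\<alpha> < 1\<close>
        by (intro submartingale_maximal_ineq_sequence[OF X d(1)]) (simp add: zeta_def)
      finally show ?thesis .
    qed
    then show "(\<integral>\<^sup>+\<omega>. of_bool (E m \<omega>) * indicator {x0<..} m \<partial>M)
        \<le> (\<integral>\<^sup>+\<omega>. ennreal (max 0 (X T \<omega> - zeta \<alpha> m) / (m - zeta \<alpha> m)) \<partial>M) * indicator {x0<..} m"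
      by (auto simp: indicator_def)
  qed
  finally have *: "(\<integral>\<^sup>+\<omega>. ennreal (running_max X T \<omega> powr p) \<partial>M)
      \<le> ennreal (x0 powr p) + (\<integral>\<^sup>+m\<in>{x0<..}. (\<integral>\<^sup>+\<omega>. ennreal (max 0 (X T \<omega> - zeta \<alpha> m) / (m - zeta \<alpha> m)) \<partial>M) \<partial>?\<mu>)"
    by (simp add: add_left_mono)
  then show ?thesis
    by (simp add: expect_nonneg_def UB_def pow_def less_eq_ennreal.rep_eq plus_ennreal.rep_eq)
qed

section \<open>Comparing the integrated bound with the bound of Doob\<close>

lemma UB_pow_zeta_eq:
  assumes XT [measurable]: "X T \<in> borel_measurable M" and nn: "\<And>\<omega>. \<omega> \<in> space M \<Longrightarrow> 0 \<le> X T \<omega>"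
    and p: "1 < p" and x0: "0 \<le> x0"
  shows "UB M T x0 X (pow p) (zeta ((p - 1) / p)) = enn2ereal (ennreal (x0 powr p) +
    (\<integral>\<^sup>+\<omega>. ennreal (if (p - 1) / p * x0 \<le> X T \<omega> then tangent_gap p x0 (X T \<omega>) else 0) \<partial>M))"
proof -
  let ?\<mu> = "pow_measure p x0" and ?\<alpha> = "(p - 1) / p"
  have "0 < p" using p by simp
  interpret \<mu>: sigma_finite_measure ?\<mu>
    by (rule sigma_finite_interval_measure[OF pow_max_mono[OF x0 \<open>0 < p\<close>] pow_max_right_cont[OF x0 \<open>0 < p\<close>]])
  interpret pair_sigma_finite ?\<mu> M ..
  have "(\<integral>\<^sup>+m\<in>{x0<..}. (\<integral>\<^sup>+\<omega>. ennreal (max 0 (X T \<omega> - zeta ?\<alpha> m) / (m - zeta ?\<alpha> m)) \<partial>M) \<partial>?\<mu>)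
      = (\<integral>\<^sup>+m. (\<integral>\<^sup>+\<omega>. ennreal (max 0 (X T \<omega> - ?\<alpha> * m) / (m - ?\<alpha> * m)) * indicator {x0<..} m \<partial>M) \<partial>?\<mu>)"
    unfolding zeta_def by (intro nn_integral_cong nn_integral_multc[symmetric]) measurable
  also have "\<dots> = (\<integral>\<^sup>+\<omega>. (\<integral>\<^sup>+m\<in>{x0<..}. ennreal (max 0 (X T \<omega> - ?\<alpha> * m) / (m - ?\<alpha> * m)) \<partial>?\<mu>) \<partial>M)"
    by (rule Fubini'[symmetric]) measurable
  also have "\<dots> = (\<integral>\<^sup>+\<omega>. ennreal (if ?\<alpha> * x0 \<le> X T \<omega> then tangent_gap p x0 (X T \<omega>) else 0) \<partial>M)"
    using nn_integral_stop_loss_pow_measure[OF p x0 nn] by (intro nn_integral_cong) (simp add: zeta_def)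
  finally show ?thesis
    by (simp add: UB_def pow_def plus_ennreal.rep_eq)
qed

lemma integrable_powr_if_expect_nonneg_finite:
  assumes [measurable]: "Y \<in> borel_measurable M" and "expect_nonneg M (\<lambda>\<omega>. Y \<omega> powr p) < \<infinity>"
  shows "integrable M (\<lambda>\<omega>. Y \<omega> powr p)"
proof (rule integrableI_nonneg)
  have "enn2ereal (\<integral>\<^sup>+\<omega>. ennreal (Y \<omega> powr p) \<partial>M) < enn2ereal \<top>"
    using assms(2) by (simp add: expect_nonneg_def)
  then show "(\<integral>\<^sup>+\<omega>. ennreal (Y \<omega> powr p) \<partial>M) < \<infinity>"
    by (simp only: less_ennreal.rep_eq infinity_ennreal_def)
qed auto

text \<open>The difference between Doob's bound and \<^const>\<open>UB\<close> for a terminal value \<open>Y\<close> with finite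
\<open>p\<close>-th moment: what the tangent gap contributes below its
point of tangency, where the integrated stop-loss payoff vanishes, plus what replacing \<open>E Y\<close> by
\<open>x0\<close> in the tangent costs.\<close>

definition UB_slack :: "real \<Rightarrow> real \<Rightarrow> ('a \<Rightarrow> real) \<Rightarrow> real" where
  "UB_slack p x0 Y =
     (\<integral>\<omega>. (if Y \<omega> < (p - 1) / p * x0 then tangent_gap p x0 (Y \<omega>) else 0) \<partial>M)
     + p\<^sup>2 / (p - 1) * x0 powr (p - 1) * ((\<integral>\<omega>. Y \<omega> \<partial>M) - x0)"

text \<open>The stop-loss payoff is the tangent gap \<open>k\<close> minus its part on \<open>low\<close>. The expectation of \<open>k\<close> is
affine in \<open>E X\<^sub>T\<^sup>p\<close> and \<open>E X\<^sub>T\<close>, and the constants combine by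
\<open>p\<^sup>2 / (p - 1) = p / (p - 1) + p\<close>.\<close>

lemma
  assumes XT: "integrable M (X T)" and nn: "\<And>\<omega>. \<omega> \<in> space M \<Longrightarrow> 0 \<le> X T \<omega>"
    and XTp: "integrable M (\<lambda>\<omega>. X T \<omega> powr p)"
    and p: "1 < p" and x0: "0 \<le> x0"
  shows doob_bound_eq_UB_plus_slack:
      "doob_bound M T p x0 X = UB M T x0 X (pow p) (zeta ((p - 1) / p)) + ereal (UB_slack p x0 (X T))"
    and integrable_tangent_gap_below:
      "integrable M (\<lambda>\<omega>. if X T \<omega> < (p - 1) / p * x0 then tangent_gap p x0 (X T \<omega>) else 0)"
    and UB_finite: "\<bar>UB M T x0 X (pow p) (zeta ((p - 1) / p))\<bar> \<noteq> \<infinity>"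
proof -
  have [measurable]: "X T \<in> borel_measurable M" using XT by auto
  define k where "k \<omega> = tangent_gap p x0 (X T \<omega>)" for \<omega>
  define low where "low = {\<omega> \<in> space M. X T \<omega> < (p - 1) / p * x0}"
  have [measurable]: "low \<in> sets M" unfolding low_def by measurable
  have k_int: "integrable M k"
    unfolding k_def tangent_gap_def using XT XTp by auto
  have k_nonneg: "0 \<le> k \<omega>" if "\<omega> \<in> space M" for \<omega>
    unfolding k_def using tangent_gap_nonneg[OF p x0 nn[OF that]] .
  have int_k: "(\<integral>\<omega>. k \<omega> \<partial>M) = (p / (p - 1)) powr p * (\<integral>\<omega>. X T \<omega> powr p \<partial>M)
      - p\<^sup>2 / (p - 1) * x0 powr (p - 1) * (\<integral>\<omega>. X T \<omega> \<partial>M) + (p - 1) * x0 powr p"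
    unfolding k_def tangent_gap_def using XT XTp by (simp add: prob_space)
  have low_int: "integrable M (\<lambda>\<omega>. indicator low \<omega> * k \<omega>)"
    using integrable_mult_indicator[OF _ k_int, of low] by simp
  have low_eq: "(if X T \<omega> < (p - 1) / p * x0 then tangent_gap p x0 (X T \<omega>) else 0) = indicator low \<omega> * k \<omega>"
    if "\<omega> \<in> space M" for \<omega>
    using that by (auto simp: low_def k_def)
  show "integrable M (\<lambda>\<omega>. if X T \<omega> < (p - 1) / p * x0 then tangent_gap p x0 (X T \<omega>) else 0)"
    using low_int by (subst Bochner_Integration.integrable_cong[OF refl low_eq]) auto
  define s where "s = (\<integral>\<omega>. indicator low \<omega> * k \<omega> \<partial>M)"
  have slack: "UB_slack p x0 (X T) = s + p\<^sup>2 / (p - 1) * x0 powr (p - 1) * ((\<integral>\<omega>. X T \<omega> \<partial>M) - x0)"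
    unfolding UB_slack_def s_def using Bochner_Integration.integral_cong[OF refl low_eq] by simp
  have "(\<integral>\<^sup>+\<omega>. ennreal (if (p - 1) / p * x0 \<le> X T \<omega> then tangent_gap p x0 (X T \<omega>) else 0) \<partial>M)
      = (\<integral>\<^sup>+\<omega>. ennreal (k \<omega> - indicator low \<omega> * k \<omega>) \<partial>M)"
    by (intro nn_integral_cong) (auto simp: low_def k_def)
  also have "\<dots> = ennreal ((\<integral>\<omega>. k \<omega> \<partial>M) - s)"
    unfolding s_def using k_int low_int k_nonneg
    by (subst nn_integral_eq_integral) (auto simp: indicator_def)
  finally have nn_eq: "(\<integral>\<^sup>+\<omega>. ennreal (if (p - 1) / p * x0 \<le> X T \<omega> then tangent_gap p x0 (X T \<omega>) else 0) \<partial>M)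
      = ennreal ((\<integral>\<omega>. k \<omega> \<partial>M) - s)" .
  have "s \<le> (\<integral>\<omega>. k \<omega> \<partial>M)"
    unfolding s_def using k_int low_int k_nonneg by (intro integral_mono) (auto simp: indicator_def)
  then have "enn2ereal (ennreal (x0 powr p) + ennreal ((\<integral>\<omega>. k \<omega> \<partial>M) - s))
      = ereal (x0 powr p + ((\<integral>\<omega>. k \<omega> \<partial>M) - s))"
    by (simp add: ennreal_plus[symmetric] del: ennreal_plus)
  then have UB_eq: "UB M T x0 X (pow p) (zeta ((p - 1) / p)) = ereal (x0 powr p + ((\<integral>\<omega>. k \<omega> \<partial>M) - s))"
    using UB_pow_zeta_eq[of X T p x0] nn p x0 by (simp only: nn_eq) simp
  then show "\<bar>UB M T x0 X (pow p) (zeta ((p - 1) / p))\<bar> \<noteq> \<infinity>" by simp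
  have doob_eq: "doob_bound M T p x0 X
      = ereal ((p / (p - 1)) powr p * (\<integral>\<omega>. X T \<omega> powr p \<partial>M) - p / (p - 1) * x0 powr p)"
    using XTp by (simp add: doob_bound_def expect_nonneg_def nn_integral_eq_integral)
  have "x0 powr (p - 1) * x0 = x0 powr p" using powr_pred_mult[OF x0] .
  then have x0_pow: "p\<^sup>2 / (p - 1) * x0 powr (p - 1) * x0 = p\<^sup>2 / (p - 1) * x0 powr p"
    by (simp add: mult.assoc)
  have "p\<^sup>2 / (p - 1) = p / (p - 1) + p"
    using p by (simp add: field_simps power2_eq_square)
  then have coeff: "p\<^sup>2 / (p - 1) * x0 powr p = p / (p - 1) * x0 powr p + p * x0 powr p"
    by (simp add: distrib_right)
  show "doob_bound M T p x0 X = UB M T x0 X (pow p) (zeta ((p - 1) / p)) + ereal (UB_slack p x0 (X T))"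
    unfolding UB_eq doob_eq slack int_k right_diff_distrib x0_pow coeff
    by (simp add: algebra_simps)
qed

lemma submartingale_expectation_mono:
  assumes "submartingale M T X" "0 \<le> s" "s \<le> t" "t \<le> T"
  shows "(\<integral>\<omega>. X s \<omega> \<partial>M) \<le> (\<integral>\<omega>. X t \<omega> \<partial>M)"
proof -
  have "space M \<in> sets (natural_filtration M X s)"
    using sets.top[of "natural_filtration M X s"] by simp
  from submartingale_set_integral_mono[OF assms this] show ?thesis
    using submartingale_integrable[OF assms(1)] assms by (simp add: set_integral_space)
qed

lemma starts_at_expectation:
  assumes X0: "starts_at M x0 X" and "X 0 \<in> borel_measurable M"
  shows "(\<integral>\<omega>. X 0 \<omega> \<partial>M) = x0"
proof -
  have "(\<integral>\<omega>. X 0 \<omega> \<partial>M) = (\<integral>\<omega>. x0 \<partial>M)"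
    using assms by (intro integral_cong_AE) (auto simp: starts_at_def)
  then show ?thesis by (simp add: prob_space)
qed

text \<open>Expectations of a submartingale increase, so equal expectations at \<open>0\<close> and \<open>T\<close> force them to be
constant; then the defining inequality compares two variables with the same expectation and is an
equality almost surely.\<close>

lemma submartingale_is_martingale_iff:
  assumes X: "submartingale M T X" and "0 \<le> T"
  shows "martingale M T X \<longleftrightarrow> (\<integral>\<omega>. X 0 \<omega> \<partial>M) = (\<integral>\<omega>. X T \<omega> \<partial>M)"
proof
  assume "martingale M T X"
  then have "AE \<omega> in M. X 0 \<omega> = real_cond_exp M (natural_filtration M X 0) (X T) \<omega>"
    using \<open>0 \<le> T\<close> unfolding martingale_def martingale_wrt_def by blast
  moreover interpret F: sigma_finite_subalgebra M "natural_filtration M X 0"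
    using submartingale_sigma_finite_subalgebra[OF X] \<open>0 \<le> T\<close> by simp
  have int: "integrable M (X 0)" "integrable M (X T)"
    using submartingale_integrable[OF X] \<open>0 \<le> T\<close> by auto
  ultimately have "(\<integral>\<omega>. X 0 \<omega> \<partial>M) = (\<integral>\<omega>. real_cond_exp M (natural_filtration M X 0) (X T) \<omega> \<partial>M)"
    using int F.real_cond_exp_int(1)[OF int(2)] by (intro integral_cong_AE) auto
  then show "(\<integral>\<omega>. X 0 \<omega> \<partial>M) = (\<integral>\<omega>. X T \<omega> \<partial>M)"
    using F.real_cond_exp_int(2)[OF int(2)] by simp
next
  assume eq: "(\<integral>\<omega>. X 0 \<omega> \<partial>M) = (\<integral>\<omega>. X T \<omega> \<partial>M)"
  have "AE \<omega> in M. X s \<omega> = real_cond_exp M (natural_filtration M X s) (X t) \<omega>"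
    if st: "0 \<le> s" "s \<le> t" "t \<le> T" for s t
  proof -
    interpret F: sigma_finite_subalgebra M "natural_filtration M X s"
      using submartingale_sigma_finite_subalgebra[OF X] st by simp
    let ?C = "real_cond_exp M (natural_filtration M X s) (X t)"
    have int: "integrable M (X s)" "integrable M (X t)"
      using submartingale_integrable[OF X] st by auto
    have C_int: "integrable M ?C" by (rule F.real_cond_exp_int(1)[OF int(2)])
    have le: "AE \<omega> in M. X s \<omega> \<le> ?C \<omega>"
      using X st unfolding submartingale_def submartingale_wrt_def by blast
    have "(\<integral>\<omega>. X s \<omega> \<partial>M) = (\<integral>\<omega>. X t \<omega> \<partial>M)"
      using submartingale_expectation_mono[OF X, of 0 s] submartingale_expectation_mono[OF X, of s t]
        submartingale_expectation_mono[OF X, of t T] st eq by linarith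
    also have "\<dots> = (\<integral>\<omega>. ?C \<omega> \<partial>M)"
      by (rule F.real_cond_exp_int(2)[OF int(2), symmetric])
    finally have "(\<integral>\<omega>. ?C \<omega> - X s \<omega> \<partial>M) = 0"
      using int(1) C_int by simp
    then have "AE \<omega> in M. ?C \<omega> - X s \<omega> = 0"
      using le int(1) C_int by (subst (asm) integral_nonneg_eq_0_iff_AE) auto
    then show ?thesis by eventually_elim simp
  qed
  then show "martingale M T X"
    using X unfolding submartingale_def submartingale_wrt_def martingale_def martingale_wrt_def by blast
qed

lemma UB_slack_nonneg:
  assumes "\<And>\<omega>. \<omega> \<in> space M \<Longrightarrow> 0 \<le> Y \<omega>" "1 < p" "0 \<le> x0" "x0 \<le> (\<integral>\<omega>. Y \<omega> \<partial>M)"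
  shows "0 \<le> UB_slack p x0 Y"
  unfolding UB_slack_def using assms tangent_gap_nonneg
  by (intro add_nonneg_nonneg mult_nonneg_nonneg Bochner_Integration.integral_nonneg) auto

text \<open>Both summands are nonnegative. The first is the integral of a nonnegative function
that vanishes exactly off the event \<open>Y < (p - 1) / p * x0\<close>, by strict convexity.\<close>

lemma UB_slack_pos_iff:
  assumes Y: "integrable M Y" "\<And>\<omega>. \<omega> \<in> space M \<Longrightarrow> 0 \<le> Y \<omega>"
    and p: "1 < p" and x0: "0 < x0" and ge: "x0 \<le> (\<integral>\<omega>. Y \<omega> \<partial>M)"
    and int: "integrable M (\<lambda>\<omega>. if Y \<omega> < (p - 1) / p * x0 then tangent_gap p x0 (Y \<omega>) else 0)"
  shows "0 < UB_slack p x0 Y \<longleftrightarrow>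
    0 < measure M {\<omega> \<in> space M. Y \<omega> < (p - 1) / p * x0} \<or> x0 < (\<integral>\<omega>. Y \<omega> \<partial>M)"
proof -
  let ?low = "{\<omega> \<in> space M. Y \<omega> < (p - 1) / p * x0}"
  let ?k = "\<lambda>\<omega>. if Y \<omega> < (p - 1) / p * x0 then tangent_gap p x0 (Y \<omega>) else 0"
  have [measurable]: "Y \<in> borel_measurable M" using Y by auto
  have k_nonneg: "0 \<le> ?k \<omega>" if "\<omega> \<in> space M" for \<omega>
    using tangent_gap_nonneg[OF p _ Y(2)[OF that]] x0 by auto
  have k_zero: "?k \<omega> = 0 \<longleftrightarrow> \<not> Y \<omega> < (p - 1) / p * x0" if "\<omega> \<in> space M" for \<omega>
    using tangent_gap_pos[OF p x0 Y(2)[OF that]] by auto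
  have "(\<integral>\<omega>. ?k \<omega> \<partial>M) = 0 \<longleftrightarrow> (AE \<omega> in M. ?k \<omega> = 0)"
    using int k_nonneg by (intro integral_nonneg_eq_0_iff_AE) auto
  also have "\<dots> \<longleftrightarrow> (AE \<omega> in M. \<not> Y \<omega> < (p - 1) / p * x0)"
    by (intro AE_cong k_zero)
  also have "\<dots> \<longleftrightarrow> prob ?low = 0"
    by (subst AE_iff_measurable[of ?low]) (auto simp: emeasure_eq_measure)
  finally have "(\<integral>\<omega>. ?k \<omega> \<partial>M) = 0 \<longleftrightarrow> prob ?low = 0" .
  moreover have "0 \<le> (\<integral>\<omega>. ?k \<omega> \<partial>M)"
    using k_nonneg by (intro Bochner_Integration.integral_nonneg)
  ultimately have "0 < (\<integral>\<omega>. ?k \<omega> \<partial>M) \<longleftrightarrow> 0 < prob ?low"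
    by (simp add: order.strict_iff_order)
  moreover define c where "c = p\<^sup>2 / (p - 1) * x0 powr (p - 1)"
  have "0 < c" using p x0 by (simp add: c_def)
  then have "0 < c * ((\<integral>\<omega>. Y \<omega> \<partial>M) - x0) \<longleftrightarrow> x0 < (\<integral>\<omega>. Y \<omega> \<partial>M)"
    and "0 \<le> c * ((\<integral>\<omega>. Y \<omega> \<partial>M) - x0)"
    using ge by (auto simp: zero_less_mult_iff)
  ultimately show ?thesis
    unfolding UB_slack_def c_def[symmetric] using \<open>0 \<le> (\<integral>\<omega>. ?k \<omega> \<partial>M)\<close> by linarith
qed

text \<open>Together with the bound by \<^const>\<open>UB\<close>, this transfers an infinite \<open>p\<close>-th moment of the terminal
value to the maximum and to \<^const>\<open>UB\<close>.\<close>

lemma expect_terminal_le_expect_running_max: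
  assumes "nonneg_process M T X" "cadlag M T X" "0 \<le> T" "0 \<le> p"
  shows "expect_nonneg M (\<lambda>\<omega>. X T \<omega> powr p) \<le> expect_nonneg M (\<lambda>\<omega>. running_max X T \<omega> powr p)"
  unfolding expect_nonneg_def less_eq_ennreal.rep_eq[symmetric]
  using assms running_max_upper[OF assms(2)]
  by (intro nn_integral_mono ennreal_leI powr_mono2) (auto simp: nonneg_process_def)

lemma doob_bound_infinite:
  assumes "\<not> expect_nonneg M (\<lambda>\<omega>. X T \<omega> powr p) < \<infinity>" "1 < p"
  shows "doob_bound M T p x0 X = \<infinity>"
  using assms by (simp add: doob_bound_def)

lemma UB_le_doob_bound:
  assumes nn: "nonneg_process M T X" and X: "submartingale M T X" and X0: "starts_at M x0 X"
    and "0 \<le> T" "0 \<le> x0" "1 < p"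
  shows "UB M T x0 X (pow p) (zeta ((p - 1) / p)) \<le> doob_bound M T p x0 X"
proof (cases "expect_nonneg M (\<lambda>\<omega>. X T \<omega> powr p) < \<infinity>")
  case True
  have int: "integrable M (X T)" "integrable M (X 0)"
    using submartingale_integrable[OF X] \<open>0 \<le> T\<close> by auto
  have nnT: "0 \<le> X T \<omega>" if "\<omega> \<in> space M" for \<omega>
    using nn that \<open>0 \<le> T\<close> by (auto simp: nonneg_process_def)
  have XTp: "integrable M (\<lambda>\<omega>. X T \<omega> powr p)"
    using integrable_powr_if_expect_nonneg_finite[OF _ True] int by auto
  have "x0 \<le> (\<integral>\<omega>. X T \<omega> \<partial>M)"
    using submartingale_expectation_mono[OF X, of 0 T] starts_at_expectation[OF X0] int \<open>0 \<le> T\<close> by auto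
  then have "0 \<le> UB_slack p x0 (X T)"
    using assms nnT by (intro UB_slack_nonneg) auto
  then show ?thesis
    using doob_bound_eq_UB_plus_slack[where X = X and T = T, OF int(1) nnT XTp \<open>1 < p\<close> \<open>0 \<le> x0\<close>]
    by (cases "UB M T x0 X (pow p) (zeta ((p - 1) / p))") auto
qed (simp add: doob_bound_infinite \<open>1 < p\<close>)

text \<open>If the terminal value has infinite \<open>p\<close>-th moment, both sides of the equivalence fail, since the maximum and
\<^const>\<open>UB\<close> are infinite as well. Otherwise \<^const>\<open>UB\<close> is finite, hence so is the moment
of the maximum, and strictness means that the slack is positive.\<close>

lemma UB_less_doob_bound_iff:
  assumes nn: "nonneg_process M T X" and cad: "cadlag M T X" and X: "submartingale M T X"
    and X0: "starts_at M x0 X" and "0 < T" "0 < x0" "1 < p"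
  shows "UB M T x0 X (pow p) (zeta ((p - 1) / p)) < doob_bound M T p x0 X \<longleftrightarrow>
    expect_nonneg M (\<lambda>\<omega>. running_max X T \<omega> powr p) < \<infinity> \<and>
    (0 < measure M {\<omega> \<in> space M. X T \<omega> < (p - 1) / p * x0} \<or> \<not> martingale M T X)"
proof -
  let ?UB = "UB M T x0 X (pow p) (zeta ((p - 1) / p))"
  let ?EX = "expect_nonneg M (\<lambda>\<omega>. X T \<omega> powr p)"
  let ?Emax = "expect_nonneg M (\<lambda>\<omega>. running_max X T \<omega> powr p)"
  have "?EX \<le> ?Emax"
    using expect_terminal_le_expect_running_max[OF nn cad] assms by simp
  have "?Emax \<le> ?UB"
    using expect_running_max_powr_le_UB[OF nn cad X \<open>0 < T\<close>, of x0 p "(p - 1) / p"] assms by simp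
  show ?thesis
  proof (cases "?EX < \<infinity>")
    case False
    with \<open>?EX \<le> ?Emax\<close> have "\<not> ?Emax < \<infinity>" by auto
    with \<open>?Emax \<le> ?UB\<close> show ?thesis by auto
  next
    case True
    have int: "integrable M (X T)" "integrable M (X 0)"
      using submartingale_integrable[OF X] \<open>0 < T\<close> by auto
    have nnT: "0 \<le> X T \<omega>" if "\<omega> \<in> space M" for \<omega>
      using nn that \<open>0 < T\<close> by (auto simp: nonneg_process_def)
    have XTp: "integrable M (\<lambda>\<omega>. X T \<omega> powr p)"
      using integrable_powr_if_expect_nonneg_finite[OF _ True] int by auto
    have x0': "0 \<le> x0" using \<open>0 < x0\<close> by simp
    note fin = UB_finite[where X = X and T = T, OF int(1) nnT XTp \<open>1 < p\<close> x0']
    have EX0: "(\<integral>\<omega>. X 0 \<omega> \<partial>M) = x0" using starts_at_expectation[OF X0] int by auto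
    have ge: "x0 \<le> (\<integral>\<omega>. X T \<omega> \<partial>M)"
      using submartingale_expectation_mono[OF X, of 0 T] EX0 \<open>0 < T\<close> by auto
    have mart: "\<not> martingale M T X \<longleftrightarrow> x0 < (\<integral>\<omega>. X T \<omega> \<partial>M)"
      using submartingale_is_martingale_iff[OF X] \<open>0 < T\<close> ge by (auto simp: EX0)
    have "?Emax < \<infinity>"
      using \<open>?Emax \<le> ?UB\<close> fin by (cases ?UB) auto
    moreover have "?UB < doob_bound M T p x0 X \<longleftrightarrow> 0 < UB_slack p x0 (X T)"
      using doob_bound_eq_UB_plus_slack[where X = X and T = T, OF int(1) nnT XTp \<open>1 < p\<close> x0'] fin
      by (cases ?UB) auto
    moreover note UB_slack_pos_iff[where Y = "X T", OF int(1) nnT \<open>1 < p\<close> \<open>0 < x0\<close> ge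
        integrable_tangent_gap_below[where X = X and T = T, OF int(1) nnT XTp \<open>1 < p\<close> x0']]
    ultimately show ?thesis unfolding mart by blast
  qed
qed

section \<open>A random variable with power tails\<close>

text \<open>The probability integral transform: \<open>\<Phi> Z\<close> is uniform on \<open>(0, 1)\<close> for the distribution function
\<open>\<Phi>\<close> of \<open>Z\<close>, and \<open>V = (1 - \<Phi> Z) powr (- 1 / q)\<close>. Positivity of the density makes
\<open>\<Phi>\<close> strictly increasing, so \<open>\<Phi>\<close> attains neither \<open>0\<close> nor \<open>1\<close> and the bound \<open>1 < V\<close>
holds everywhere, not just almost surely; the paths built from \<open>V\<close> need it at every point.\<close>

lemma exists_random_variable_with_powr_tail:
  fixes Z :: "'a \<Rightarrow> real" and f :: "real \<Rightarrow> real"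
  assumes Z: "distributed M lborel Z f" and f_pos: "\<And>x. 0 < f x" and "0 < q"
  obtains V :: "'a \<Rightarrow> real" where "V \<in> borel_measurable M" "\<And>\<omega>. 1 < V \<omega>"
    "\<And>v. 1 \<le> v \<Longrightarrow> prob {\<omega> \<in> space M. v < V \<omega>} = v powr (- q)"
proof -
  have Z_meas [measurable]: "Z \<in> borel_measurable M"
    using distributed_measurable[OF Z] by simp
  have f_meas [measurable]: "(\<lambda>x. ennreal (f x)) \<in> borel_measurable borel"
    using distributed_borel_measurable[OF Z] by simp
  interpret Z: real_distribution "distr M borel Z" by simp
  define \<Phi> where "\<Phi> = cdf (distr M borel Z)"
  have distr: "distr M borel Z = density lborel (\<lambda>x. ennreal (f x))"
    using distributed_distr_eq_density[OF Z] by (simp cong: distr_cong)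
  have "\<Phi> x < \<Phi> y" if "x < y" for x y
  proof -
    have "emeasure (distr M borel Z) {x<..y} \<noteq> 0"
    proof
      assume "emeasure (distr M borel Z) {x<..y} = 0"
      then have "AE z in lborel. z \<in> {x<..y} \<longrightarrow> ennreal (f z) = 0"
        unfolding distr by (subst (asm) emeasure_density)
          (auto simp: nn_integral_0_iff_AE indicator_def split: if_splits elim!: eventually_mono)
      then have "AE z in lborel. z \<notin> {x<..y}"
        by eventually_elim (metis ennreal_eq_0_iff f_pos not_le)
      then have "emeasure lborel {x<..y} = 0"
        by (subst (asm) AE_iff_measurable[of "{x<..y}"]) auto
      then show False using that by simp
    qed
    then have "0 < measure (distr M borel Z) {x<..y}"
      by (simp add: Z.emeasure_eq_measure zero_less_measure_iff)
    then show ?thesis using Z.cdf_diff_eq[OF that] by (simp add: \<Phi>_def)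
  qed
  then have \<Phi>_mono: "strict_mono \<Phi>" by (rule strict_monoI)
  have \<Phi>_pos: "0 < \<Phi> x" for x
    using strict_monoD[OF \<Phi>_mono, of "x - 1" x] Z.cdf_nonneg[of "x - 1"] by (simp add: \<Phi>_def)
  have \<Phi>_less_1: "\<Phi> x < 1" for x
    using strict_monoD[OF \<Phi>_mono, of x "x + 1"] Z.cdf_bounded_prob[of "x + 1"] by (simp add: \<Phi>_def)
  have "emeasure (distr M borel Z) {x} = 0" for x
    unfolding distr by (subst emeasure_density) (auto simp: nn_integral_0_iff_AE intro!: AE_I[of _ _ "{x}"])
  then have \<Phi>_cont: "isCont \<Phi> x" for x
    unfolding \<Phi>_def Z.isCont_cdf by (simp add: measure_def)
  have \<Phi>_meas [measurable]: "\<Phi> \<in> borel_measurable borel"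
    using \<Phi>_cont by (intro borel_measurable_continuous_onI) (simp add: continuous_on_eq_continuous_at)
  have \<Phi>_onto: "\<exists>z. \<Phi> z = u" if u: "0 < u" "u < 1" for u
  proof -
    obtain a where a: "\<Phi> a \<le> u"
      using order_tendstoD(2)[OF Z.cdf_lim_at_bot u(1)]
      unfolding \<Phi>_def by (metis eventually_happens less_imp_le trivial_limit_at_bot_linorder)
    obtain b where b: "u \<le> \<Phi> b"
      using order_tendstoD(1)[OF Z.cdf_lim_at_top_prob u(2)]
      unfolding \<Phi>_def by (metis eventually_happens less_imp_le trivial_limit_at_top_linorder)
    have "a \<le> b" using a b strict_mono_less_eq[OF \<Phi>_mono] by force
    then show ?thesis using IVT[of \<Phi> a u b] a b \<Phi>_cont by auto
  qed
  define V where "V \<omega> = (1 - \<Phi> (Z \<omega>)) powr (- 1 / q)" for \<omega>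
  \<comment> \<open>For \<open>v = 1\<close> this also yields \<open>1 < V\<close>.\<close>
  have V_gt_iff: "v < V \<omega> \<longleftrightarrow> 1 - v powr (- q) < \<Phi> (Z \<omega>)" if "1 \<le> v" for v \<omega>
  proof -
    have "v < V \<omega> \<longleftrightarrow> V \<omega> powr (- q) < v powr (- q)"
      using that \<open>0 < q\<close> \<Phi>_less_1[of "Z \<omega>"]
        powr_less_mono2_neg[of "- q" v "V \<omega>"] powr_less_mono2_neg[of "- q" "V \<omega>" v]
      by (cases v "V \<omega>" rule: linorder_cases) (auto simp: V_def)
    also have "V \<omega> powr (- q) = 1 - \<Phi> (Z \<omega>)"
      using \<open>0 < q\<close> \<Phi>_less_1[of "Z \<omega>"] by (simp add: V_def powr_powr)
    finally show ?thesis by linarith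
  qed
  show thesis
  proof
    show "V \<in> borel_measurable M" unfolding V_def by measurable
    show V_gt_1: "1 < V \<omega>" for \<omega> using V_gt_iff[of 1 \<omega>] \<Phi>_pos by simp
    fix v :: real assume "1 \<le> v"
    show "prob {\<omega> \<in> space M. v < V \<omega>} = v powr (- q)"
    proof (cases "v = 1")
      case True
      then have "{\<omega> \<in> space M. v < V \<omega>} = space M" using V_gt_1 by auto
      then show ?thesis using True by (simp add: prob_space)
    next
      case False
      then have "v powr (- q) < 1" "0 < v powr (- q)"
        using \<open>1 \<le> v\<close> \<open>0 < q\<close> by (auto simp: powr_less_one)
      then obtain z where z: "\<Phi> z = 1 - v powr (- q)" using \<Phi>_onto by force
      have "{\<omega> \<in> space M. v < V \<omega>} = space M - (Z -` {..z} \<inter> space M)"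
        using V_gt_iff[OF \<open>1 \<le> v\<close>] by (auto simp: z[symmetric] strict_mono_less[OF \<Phi>_mono])
      then have "prob {\<omega> \<in> space M. v < V \<omega>} = 1 - \<Phi> z"
        by (simp add: prob_compl \<Phi>_def cdf_def measure_distr)
      then show ?thesis by (simp add: z)
    qed
  qed
qed

text \<open>On \<open>V > a\<close>, write \<open>V powr r\<close> as \<open>a powr r\<close> plus its layers above \<open>a\<close>. By Fubini the layers
integrate to \<open>r m powr (r - 1) * m powr (- q)\<close> over \<open>m > a\<close>, that is, to
\<open>r / (q - r) * a powr (r - q)\<close>.\<close>

lemma powr_tail_partial_moment:
  fixes V :: "'a \<Rightarrow> real"
  assumes V [measurable]: "V \<in> borel_measurable M"
    and tail: "\<And>v. 1 \<le> v \<Longrightarrow> prob {\<omega> \<in> space M. v < V \<omega>} = v powr (- q)"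
    and r: "0 < r" "r < q" and a: "1 \<le> a"
  shows "(\<integral>\<^sup>+\<omega>. ennreal (V \<omega> powr r) * indicator {\<omega> \<in> space M. a < V \<omega>} \<omega> \<partial>M)
    = ennreal (q / (q - r) * a powr (r - q))"
proof -
  have a0: "0 \<le> a" using a by simp
  interpret \<mu>: sigma_finite_measure "pow_measure r a"
    by (rule sigma_finite_interval_measure[OF pow_max_mono[OF a0 r(1)] pow_max_right_cont[OF a0 r(1)]])
  interpret pair_sigma_finite "pow_measure r a" M ..
  define G where "G = {\<omega> \<in> space M. a < V \<omega>}"
  have [measurable]: "G \<in> sets M" unfolding G_def by measurable
  have emeasure_tail: "emeasure M {\<omega> \<in> space M. v < V \<omega>} = ennreal (v powr (- q))" if "1 \<le> v" for v
    using tail[OF that] by (simp add: emeasure_eq_measure)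
  have "(\<integral>\<^sup>+\<omega>. ennreal (V \<omega> powr r) * indicator G \<omega> \<partial>M)
      = (\<integral>\<^sup>+\<omega>. ennreal (a powr r) * indicator G \<omega>
          + (\<integral>\<^sup>+m. of_bool (m < V \<omega>) * indicator {a<..} m \<partial>pow_measure r a) \<partial>M)"
  proof (intro nn_integral_cong)
    fix \<omega> assume \<omega>: "\<omega> \<in> space M"
    show "ennreal (V \<omega> powr r) * indicator G \<omega> = ennreal (a powr r) * indicator G \<omega>
          + (\<integral>\<^sup>+m. of_bool (m < V \<omega>) * indicator {a<..} m \<partial>pow_measure r a)"
    proof (cases "\<omega> \<in> G")
      case True
      have "(\<integral>\<^sup>+m. of_bool (m < V \<omega>) * indicator {a<..} m \<partial>pow_measure r a)
          = (\<integral>\<^sup>+m\<in>{a<..}. indicator {..<V \<omega>} m \<partial>pow_measure r a)"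
        by (intro nn_integral_cong) (auto simp: indicator_def)
      then show ?thesis
        using True pow_eq_nn_integral_pow_measure[OF a0 r(1), of "V \<omega>"] by (simp add: G_def)
    next
      case False
      have "(\<integral>\<^sup>+m. of_bool (m < V \<omega>) * indicator {a<..} m \<partial>pow_measure r a) = (\<integral>\<^sup>+m. 0 \<partial>pow_measure r a)"
        using False \<omega> by (intro nn_integral_cong) (auto simp: indicator_def G_def)
      then show ?thesis using False by simp
    qed
  qed
  also have "\<dots> = ennreal (a powr r) * emeasure M G
      + (\<integral>\<^sup>+\<omega>. (\<integral>\<^sup>+m. of_bool (m < V \<omega>) * indicator {a<..} m \<partial>pow_measure r a) \<partial>M)"
    by (subst nn_integral_add) (auto simp: nn_integral_cmult_indicator of_bool_def)
  also have "(\<integral>\<^sup>+\<omega>. (\<integral>\<^sup>+m. of_bool (m < V \<omega>) * indicator {a<..} m \<partial>pow_measure r a) \<partial>M)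
      = (\<integral>\<^sup>+m. (\<integral>\<^sup>+\<omega>. of_bool (m < V \<omega>) * indicator {a<..} m \<partial>M) \<partial>pow_measure r a)"
    by (rule Fubini') (auto simp: of_bool_def)
  also have "\<dots> = (\<integral>\<^sup>+m\<in>{a<..}. ennreal (m powr (- q)) \<partial>pow_measure r a)"
  proof (intro nn_integral_cong)
    fix m
    have "(\<integral>\<^sup>+\<omega>. of_bool (m < V \<omega>) \<partial>M) = ennreal (m powr (- q))" if "a < m"
    proof -
      have "(\<integral>\<^sup>+\<omega>. of_bool (m < V \<omega>) \<partial>M) = (\<integral>\<^sup>+\<omega>. indicator {\<omega> \<in> space M. m < V \<omega>} \<omega> \<partial>M)"
        by (intro nn_integral_cong) (auto simp: indicator_def)
      then show ?thesis using emeasure_tail[of m] that a by simp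
    qed
    then show "(\<integral>\<^sup>+\<omega>. of_bool (m < V \<omega>) * indicator {a<..} m \<partial>M) = ennreal (m powr (- q)) * indicator {a<..} m"
      by (auto simp: indicator_def)
  qed
  also have "\<dots> = (\<integral>\<^sup>+m. ennreal (r * m powr (r - q - 1)) * indicator {a..} m \<partial>lborel)"
  proof (subst nn_integral_pow_measure[OF a0 r(1)])
    show "(\<integral>\<^sup>+m. ennreal (m powr (- q)) * ennreal (r * m powr (r - 1)) * indicator {a<..} m \<partial>lborel)
        = (\<integral>\<^sup>+m. ennreal (r * m powr (r - q - 1)) * indicator {a..} m \<partial>lborel)"
    proof (rule nn_integral_cong_AE)
      have "ennreal (m powr (- q)) * ennreal (r * m powr (r - 1)) = ennreal (r * m powr (r - q - 1))" for m
      proof -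
        have "m powr (- q) * m powr (r - 1) = m powr (r - q - 1)"
          by (simp add: powr_add[symmetric] algebra_simps)
        then show ?thesis using r by (simp add: ennreal_mult[symmetric] mult.left_commute)
      qed
      then show "AE m in lborel. ennreal (m powr (- q)) * ennreal (r * m powr (r - 1)) * indicator {a<..} m
          = ennreal (r * m powr (r - q - 1)) * indicator {a..} m"
        using AE_lborel_singleton[of a] by (auto simp: indicator_def elim!: eventually_mono)
    qed
  qed auto
  also have "\<dots> = ennreal (0 - r / (r - q) * a powr (r - q))"
  proof (rule nn_integral_FTC_atLeast)
    fix m assume "a \<le> m"
    then have "0 < m" using a by simp
    then have "((\<lambda>m. r / (r - q) * m powr (r - q)) has_real_derivative
        r / (r - q) * ((r - q) * m powr (r - q - 1))) (at m)"
      by (auto intro!: derivative_eq_intros)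
    then show "((\<lambda>m. r / (r - q) * m powr (r - q)) has_real_derivative r * m powr (r - q - 1)) (at m)"
      using r by simp
  next
    have "((\<lambda>m::real. m powr (r - q)) \<longlongrightarrow> 0) at_top"
      using r by (intro tendsto_neg_powr filterlim_ident) auto
    from tendsto_mult_right_zero[OF this]
    show "((\<lambda>m. r / (r - q) * m powr (r - q)) \<longlongrightarrow> 0) at_top" .
  qed (use r in auto)
  also have "emeasure M G = ennreal (a powr (- q))"
    using emeasure_tail[OF a] by (simp add: G_def)
  also have "ennreal (a powr r) * ennreal (a powr (- q)) + ennreal (0 - r / (r - q) * a powr (r - q))
      = ennreal (a powr (r - q) + r / (q - r) * a powr (r - q))"
  proof -
    have "- (r / (r - q)) = r / (q - r)" by (metis minus_diff_eq minus_divide_right)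
    then have eq: "0 - r / (r - q) * a powr (r - q) = r / (q - r) * a powr (r - q)"
      by (simp only: diff_0 mult_minus_left[symmetric])
    show ?thesis
      unfolding eq
      using r by (simp add: ennreal_mult[symmetric] ennreal_plus[symmetric] powr_add[symmetric] del: ennreal_plus)
  qed
  also have "a powr (r - q) + r / (q - r) * a powr (r - q) = q / (q - r) * a powr (r - q)"
    using r by (simp add: field_simps)
  finally show ?thesis by (simp add: G_def)
qed

end

section \<open>The single-jump martingale\<close>

text \<open>The path climbs along \<open>x * T / (T - t)\<close> and at the time \<open>T * (1 - 1 / v)\<close>, when it would reach the
level \<open>x * v\<close>, drops to \<open>x * c * v\<close>. Any increasing continuous climb from \<open>x\<close> to infinity
within \<open>[0, T)\<close> would serve; it has to be unbounded because the level of the jump is.\<close>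

definition jump_path :: "real \<Rightarrow> real \<Rightarrow> real \<Rightarrow> real \<Rightarrow> real \<Rightarrow> real" where
  "jump_path T x c v t = (if t < T * (1 - 1 / v) then x * T / (T - t) else x * c * v)"

lemma jump_time:
  fixes T v :: real
  assumes "0 < T" "1 < v"
  shows "0 < T * (1 - 1 / v)" "T * (1 - 1 / v) < T"
    and "t < T \<Longrightarrow> t < T * (1 - 1 / v) \<longleftrightarrow> T / (T - t) < v"
    and "T / (T - T * (1 - 1 / v)) = v"
  using assms by (simp_all add: field_simps)

lemma jump_path_nonneg:
  assumes "0 < T" "1 < v" "0 \<le> x" "0 \<le> c"
  shows "0 \<le> jump_path T x c v t"
proof (cases "t < T * (1 - 1 / v)")
  case True
  then have "t < T" using jump_time(2)[OF assms(1,2)] by linarith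
  then show ?thesis using True assms by (simp add: jump_path_def)
qed (use assms in \<open>simp add: jump_path_def\<close>)

lemma jump_path_le:
  assumes "0 < T" "1 < v" "0 \<le> x" "c \<le> 1"
  shows "jump_path T x c v t \<le> x * v"
proof (cases "t < T * (1 - 1 / v)")
  case True
  then have "t < T" using jump_time(2)[OF assms(1,2)] by linarith
  then have "T / (T - t) < v" using jump_time(3)[OF assms(1,2)] True by blast
  then have "x * (T / (T - t)) \<le> x * v" using assms by (intro mult_left_mono) auto
  then show ?thesis using True by (simp add: jump_path_def)
next
  case False
  have "c * v \<le> 1 * v" using assms by (intro mult_right_mono) auto
  then show ?thesis using False assms by (simp add: jump_path_def mult_left_mono mult.assoc)
qed

lemma jump_path_tendsto_before:
  assumes "0 < T" "1 < v" "t \<le> T * (1 - 1 / v)"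
  shows "(jump_path T x c v \<longlongrightarrow> x * T / (T - t)) (at_left t)"
proof (rule Lim_transform_eventually)
  have "T - t \<noteq> 0" using jump_time(2)[OF assms(1,2)] assms(3) by simp
  then show "((\<lambda>s. x * T / (T - s)) \<longlongrightarrow> x * T / (T - t)) (at_left t)"
    by (intro tendsto_intros) 
  show "\<forall>\<^sub>F s in at_left t. x * T / (T - s) = jump_path T x c v s"
    using assms(3) by (auto simp: jump_path_def eventually_at_filter)
qed

lemma cadlag_jump_path:
  assumes T: "0 < T" and v: "1 < v"
  shows "cadlag_path T (jump_path T x c v)"
  unfolding cadlag_path_def
proof safe
  let ?\<tau> = "T * (1 - 1 / v)"
  fix t
  show "continuous (at_right t) (jump_path T x c v)" if "t \<in> {0..<T}"
  proof (cases "t < ?\<tau>")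
    case True
    have "((\<lambda>s. x * T / (T - s)) \<longlongrightarrow> x * T / (T - t)) (at_right t)"
      using that by (intro tendsto_intros) auto
    moreover have "\<forall>\<^sub>F s in at_right t. x * T / (T - s) = jump_path T x c v s"
      using eventually_at_right_less[of t] order_tendstoD(2)[OF tendsto_ident_at True]
      by eventually_elim (simp add: jump_path_def)
    ultimately show ?thesis
      using True by (auto simp: continuous_within jump_path_def[of _ _ _ _ t] intro: Lim_transform_eventually)
  next
    case False
    then have "\<forall>\<^sub>F s in at_right t. x * c * v = jump_path T x c v s"
      by (auto simp: jump_path_def eventually_at_filter)
    then show ?thesis
      using False by (auto simp: continuous_within jump_path_def[of _ _ _ _ t] intro: Lim_transform_eventually)
  qed
  show "\<exists>l. (jump_path T x c v \<longlongrightarrow> l) (at_left t)" if "t \<in> {0<..T}"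
  proof (cases "t \<le> ?\<tau>")
    case True
    then show ?thesis using jump_path_tendsto_before[OF T v] by blast
  next
    case False
    then have "\<forall>\<^sub>F s in at_left t. ?\<tau> < s"
      by (intro order_tendstoD(1)[OF tendsto_ident_at]) auto
    then have "\<forall>\<^sub>F s in at_left t. x * c * v = jump_path T x c v s"
      by eventually_elim (simp add: jump_path_def)
    then show ?thesis by (intro exI[of _ "x * c * v"]) (auto intro: Lim_transform_eventually)
  qed
qed

text \<open>The supremum is the left limit at the jump; for \<open>x > 0\<close> and \<open>c < 1\<close> it is not attained.\<close>

lemma SUP_jump_path:
  assumes T: "0 < T" and v: "1 < v" and x: "0 \<le> x" and c: "c \<le> 1"
  shows "(SUP t\<in>{0..T}. jump_path T x c v t) = x * v"
proof (rule antisym)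
  show "(SUP t\<in>{0..T}. jump_path T x c v t) \<le> x * v"
    using assms by (intro cSUP_least jump_path_le) auto
  define \<tau> where "\<tau> = T * (1 - 1 / v)"
  have \<tau>: "0 < \<tau>" "\<tau> < T" "x * T / (T - \<tau>) = x * v"
    using jump_time[OF T v] unfolding \<tau>_def[symmetric] by (auto simp: times_divide_eq_right[symmetric] simp del: times_divide_eq_right)
  have "\<forall>\<^sub>F s in at_left \<tau>. s < \<tau>" by (simp add: eventually_at_filter)
  have "(jump_path T x c v \<longlongrightarrow> x * v) (at_left \<tau>)"
    using jump_path_tendsto_before[OF T v, of \<tau> x c] \<tau> by (simp add: \<tau>_def)
  moreover have "\<forall>\<^sub>F s in at_left \<tau>. jump_path T x c v s \<le> (SUP t\<in>{0..T}. jump_path T x c v t)"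
    using order_tendstoD(1)[OF tendsto_ident_at \<tau>(1)] \<open>\<forall>\<^sub>F s in at_left \<tau>. s < \<tau>\<close>
  proof eventually_elim
    case (elim s)
    then show ?case
      using \<tau> by (intro cSUP_upper cadlag_path_bdd_above cadlag_jump_path T v) auto
  qed
  ultimately show "x * v \<le> (SUP t\<in>{0..T}. jump_path T x c v t)"
    by (rule tendsto_upperbound) (use \<tau> in \<open>auto simp: trivial_limit_at_left_real\<close>)
qed

context prob_space
begin

text \<open>If the process has followed a deterministic path up to time \<open>s\<close> on \<open>G\<close>, then no event observable by
time \<open>s\<close> splits \<open>G\<close>: the sets with this property form a \<open>\<sigma>\<close>-algebra that contains the generators.
For the jump process, \<open>G\<close> is the event that the jump occurs after \<open>s\<close>.\<close>

lemma natural_filtration_atom: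
  assumes const: "\<And>r. 0 \<le> r \<Longrightarrow> r \<le> s \<Longrightarrow> \<exists>y. \<forall>\<omega>\<in>G. X r \<omega> = y" and G: "G \<subseteq> space M"
    and A: "A \<in> sets (natural_filtration M X s)"
  shows "G \<subseteq> A \<or> G \<inter> A = {}"
  using A unfolding sets_natural_filtration
proof (induction rule: sigma_sets.induct)
  case (Basic A)
  then obtain r B where "r \<in> {0..s}" "A = X r -` B \<inter> space M" by auto
  with const[of r] G show ?case by force
next
  case (Union A)
  then show ?case by (cases "\<exists>i. G \<subseteq> A i") blast+
qed (use G in auto)

text \<open>It suffices to compare each \<open>X t\<close> with the terminal value, since events observable at
time \<open>s\<close> are observable at all later times.\<close>

lemma martingale_closedI:
  assumes int: "\<And>t. 0 \<le> t \<Longrightarrow> t \<le> T \<Longrightarrow> integrable M (X t)"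
    and eq: "\<And>t A. 0 \<le> t \<Longrightarrow> t \<le> T \<Longrightarrow> A \<in> sets (natural_filtration M X t) \<Longrightarrow>
      (\<integral>\<omega>\<in>A. X t \<omega> \<partial>M) = (\<integral>\<omega>\<in>A. X T \<omega> \<partial>M)"
  shows "martingale M T X"
proof -
  have "AE \<omega> in M. X s \<omega> = real_cond_exp M (natural_filtration M X s) (X t) \<omega>"
    if st: "0 \<le> s" "s \<le> t" "t \<le> T" for s t
  proof -
    interpret F: sigma_finite_subalgebra M "natural_filtration M X s"
      using int st by (intro sigma_finite_subalgebra_natural_filtration) auto
    have "(\<integral>\<omega>\<in>A. X t \<omega> \<partial>M) = (\<integral>\<omega>\<in>A. X s \<omega> \<partial>M)" if A: "A \<in> sets (natural_filtration M X s)" for A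
      using eq[of s A] eq[of t A] A st sets_natural_filtration_mono[of s t] by auto
    then have "AE \<omega> in M. real_cond_exp M (natural_filtration M X s) (X t) \<omega> = X s \<omega>"
      using st int measurable_natural_filtration[of s s] by (intro F.real_cond_exp_charact) auto
    then show ?thesis by eventually_elim simp
  qed
  then show ?thesis
    using int measurable_natural_filtration unfolding martingale_def martingale_wrt_def by auto
qed

lemma martingale_imp_submartingale:
  assumes "martingale M T X"
  shows "submartingale M T X"
proof -
  have "AE \<omega> in M. X s \<omega> \<le> real_cond_exp M (natural_filtration M X s) (X t) \<omega>"
    if "0 \<le> s" "s \<le> t" "t \<le> T" for s t
  proof -
    have "AE \<omega> in M. X s \<omega> = real_cond_exp M (natural_filtration M X s) (X t) \<omega>"
      using assms that unfolding martingale_def martingale_wrt_def by blast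
    then show ?thesis by eventually_elim simp
  qed
  then show ?thesis
    using assms unfolding martingale_def martingale_wrt_def submartingale_def submartingale_wrt_def by blast
qed

text \<open>After the jump the process is constant, so only the event \<open>G t\<close> that the jump is still to come matters,
and by \<open>natural_filtration_atom\<close> an observable event contains it or misses it. On \<open>G t\<close>
the present value is \<open>x * a\<close> with \<open>a = T / (T - t)\<close>, while \<open>G t\<close> is the event \<open>V > a\<close>. The partial moment
\<open>E[V; V > a] = q / (q - 1) * a * P(V > a)\<close> shows that \<open>c = (q - 1) / q\<close> is the fraction for which the
terminal value \<open>x * c * V\<close> has the right expectation.\<close>

lemma jump_process_martingale:
  fixes V :: "'a \<Rightarrow> real"
  assumes V [measurable]: "V \<in> borel_measurable M" and V_gt_1: "\<And>\<omega>. 1 < V \<omega>"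
    and tail: "\<And>v. 1 \<le> v \<Longrightarrow> prob {\<omega> \<in> space M. v < V \<omega>} = v powr (- q)"
    and q: "1 < q" and T: "0 < T" and x: "0 \<le> x"
  shows "martingale M T (\<lambda>t \<omega>. jump_path T x ((q - 1) / q) (V \<omega>) t)"
proof -
  define c where "c = (q - 1) / q"
  define X where "X t \<omega> = jump_path T x c (V \<omega>) t" for t \<omega>
  define G where "G t = {\<omega> \<in> space M. t < T * (1 - 1 / V \<omega>)}" for t
  have V_pos: "0 < V \<omega>" for \<omega> using V_gt_1[of \<omega>] by linarith
  have c: "0 \<le> c" "c \<le> 1" using q by (auto simp: c_def)
  have [measurable]: "X t \<in> borel_measurable M" for t
    unfolding X_def jump_path_def by measurable
  have [measurable]: "G t \<in> sets M" for t unfolding G_def by measurable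
  have V_partial: "has_bochner_integral M (\<lambda>\<omega>. V \<omega> * indicator {\<omega> \<in> space M. a < V \<omega>} \<omega>) (q / (q - 1) * a powr (1 - q))"
    if a: "1 \<le> a" for a
  proof (rule has_bochner_integral_nn_integral)
    have "(\<integral>\<^sup>+\<omega>. ennreal (V \<omega> * indicator {\<omega> \<in> space M. a < V \<omega>} \<omega>) \<partial>M)
        = (\<integral>\<^sup>+\<omega>. ennreal (V \<omega> powr 1) * indicator {\<omega> \<in> space M. a < V \<omega>} \<omega> \<partial>M)"
      using V_gt_1 by (intro nn_integral_cong) (auto simp: indicator_def abs_of_pos[OF V_pos])
    then show "(\<integral>\<^sup>+\<omega>. ennreal (V \<omega> * indicator {\<omega> \<in> space M. a < V \<omega>} \<omega>) \<partial>M) = ennreal (q / (q - 1) * a powr (1 - q))"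
      using powr_tail_partial_moment[OF V tail _ q a] by simp
    show "AE \<omega> in M. 0 \<le> V \<omega> * indicator {\<omega> \<in> space M. a < V \<omega>} \<omega>"
      by (intro AE_I2) (auto simp: indicator_def less_imp_le[OF V_pos])
  qed (use q in auto)
  have V_int: "integrable M V"
  proof -
    have "integrable M (\<lambda>\<omega>. V \<omega> * indicator {\<omega> \<in> space M. 1 < V \<omega>} \<omega>)"
      using V_partial[of 1] by (auto simp: has_bochner_integral_iff)
    moreover have "V \<omega> * indicator {\<omega> \<in> space M. 1 < V \<omega>} \<omega> = V \<omega>" if "\<omega> \<in> space M" for \<omega>
      using that V_gt_1[of \<omega>] by simp
    ultimately show ?thesis
      using Bochner_Integration.integrable_cong[OF refl, of M "\<lambda>\<omega>. V \<omega> * indicator {\<omega> \<in> space M. 1 < V \<omega>} \<omega>" V]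
      by blast
  qed
  have X_int: "integrable M (X t)" for t
  proof (rule Bochner_Integration.integrable_bound)
    show "integrable M (\<lambda>\<omega>. x * V \<omega>)" using V_int by simp
    show "AE \<omega> in M. norm (X t \<omega>) \<le> norm (x * V \<omega>)"
    proof (intro AE_I2)
      fix \<omega>
      have "0 \<le> X t \<omega>" "X t \<omega> \<le> x * V \<omega>"
        unfolding X_def using jump_path_nonneg[OF T V_gt_1 x c(1)] jump_path_le[OF T V_gt_1 x c(2)] by auto
      then show "norm (X t \<omega>) \<le> norm (x * V \<omega>)" by simp
    qed
  qed simp
  have X_T: "X T \<omega> = x * c * V \<omega>" for \<omega>
    using jump_time(2)[OF T V_gt_1[of \<omega>]] by (simp add: X_def jump_path_def)
  have balance: "(\<integral>\<omega>. indicator (G t) \<omega> * (X T \<omega> - X t \<omega>) \<partial>M) = 0" if t: "0 \<le> t" "t \<le> T" for t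
  proof (cases "t = T")
    case False
    then have "t < T" using t by simp
    define a where "a = T / (T - t)"
    have a: "1 \<le> a" using t \<open>t < T\<close> by (simp add: a_def field_simps)
    have G_eq: "G t = {\<omega> \<in> space M. a < V \<omega>}"
      using jump_time(3)[OF T V_gt_1 \<open>t < T\<close>] by (auto simp: G_def a_def)
    define W where "W \<omega> = V \<omega> * indicator {\<omega> \<in> space M. a < V \<omega>} \<omega>" for \<omega>
    have W: "integrable M W" "(\<integral>\<omega>. W \<omega> \<partial>M) = q / (q - 1) * a powr (1 - q)"
      using V_partial[OF a] unfolding W_def has_bochner_integral_iff by auto
    have "(\<integral>\<omega>. indicator (G t) \<omega> * (X T \<omega> - X t \<omega>) \<partial>M)
        = (\<integral>\<omega>. x * c * W \<omega> - x * a * indicator (G t) \<omega> \<partial>M)"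
    proof (rule Bochner_Integration.integral_cong[OF refl])
      fix \<omega> assume \<omega>: "\<omega> \<in> space M"
      show "indicator (G t) \<omega> * (X T \<omega> - X t \<omega>)
          = x * c * W \<omega> - x * a * indicator (G t) \<omega>"
      proof (cases "\<omega> \<in> G t")
        case True
        then have "X t \<omega> = x * a" by (simp add: G_def X_def jump_path_def a_def)
        then show ?thesis using True by (simp add: X_T W_def G_eq[symmetric])
      qed (simp add: W_def G_eq[symmetric])
    qed
    also have "\<dots> = x * c * (q / (q - 1) * a powr (1 - q)) - x * a * prob (G t)"
    proof -
      have "integrable M (indicator (G t) :: 'a \<Rightarrow> real)"
        by (rule integrable_real_indicator) (auto simp: emeasure_eq_measure)
      then show ?thesis using W by simp
    qed
    also have "\<dots> = 0"
    proof -
      have tail_a: "prob (G t) = a powr (- q)" using tail[OF a] by (simp add: G_eq)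
      have a_pow: "a * a powr (- q) = a powr (1 - q)"
        using powr_mult_base[of a "- q"] a by simp
      have c_ratio: "c * (q / (q - 1)) = 1"
        using q by (simp add: c_def)
      have "x * c * (q / (q - 1) * a powr (1 - q)) - x * a * prob (G t)
          = x * (c * (q / (q - 1))) * a powr (1 - q) - x * (a * prob (G t))"
        by (simp only: mult.assoc)
      then show ?thesis unfolding tail_a a_pow c_ratio by simp
    qed
    finally show ?thesis .
  qed (simp)
  have "martingale M T X"
  proof (rule martingale_closedI)
    fix t A assume t: "0 \<le> t" "t \<le> T" and A: "A \<in> sets (natural_filtration M X t)"
    interpret F: sigma_finite_subalgebra M "natural_filtration M X t"
      by (rule sigma_finite_subalgebra_natural_filtration) simp
    have [measurable]: "A \<in> sets M" using A F.subalg by (auto simp: subalgebra_def)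
    have stopped: "X T \<omega> = X t \<omega>" if "\<omega> \<in> space M" "\<omega> \<notin> G t" for \<omega>
      using that by (simp add: X_T) (simp add: X_def jump_path_def G_def)
    have atom: "G t \<subseteq> A \<or> G t \<inter> A = {}"
      using A
    proof (rule natural_filtration_atom[rotated 2])
      fix r assume "0 \<le> r" "r \<le> t"
      then show "\<exists>y. \<forall>\<omega>\<in>G t. X r \<omega> = y"
        by (intro exI[of _ "x * T / (T - r)"]) (auto simp: X_def jump_path_def G_def)
    qed (auto simp: G_def)
    have int_A: "integrable M (\<lambda>\<omega>. indicator A \<omega> * X r \<omega>)" for r
      using integrable_mult_indicator[OF _ X_int[of r], of A] by simp
    have "(\<integral>\<omega>\<in>A. X T \<omega> \<partial>M) - (\<integral>\<omega>\<in>A. X t \<omega> \<partial>M) = (\<integral>\<omega>. indicator A \<omega> * X T \<omega> - indicator A \<omega> * X t \<omega> \<partial>M)"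
      using int_A by (simp add: set_lebesgue_integral_def)
    also have "\<dots> = (\<integral>\<omega>. (if G t \<subseteq> A then 1 else 0) * (indicator (G t) \<omega> * (X T \<omega> - X t \<omega>)) \<partial>M)"
    proof (rule Bochner_Integration.integral_cong[OF refl])
      fix \<omega> assume "\<omega> \<in> space M"
      then show "indicator A \<omega> * X T \<omega> - indicator A \<omega> * X t \<omega>
          = (if G t \<subseteq> A then 1 else 0) * (indicator (G t) \<omega> * (X T \<omega> - X t \<omega>))"
      proof (cases "\<omega> \<in> G t")
        case True
        then have "G t \<subseteq> A \<longleftrightarrow> \<omega> \<in> A" using atom by blast
        then show ?thesis using True by simp
      qed (use stopped in simp)
    qed
    also have "\<dots> = 0"
      using balance[OF t] by simp
    finally show "(\<integral>\<omega>\<in>A. X t \<omega> \<partial>M) = (\<integral>\<omega>\<in>A. X T \<omega> \<partial>M)" by simp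
  qed (rule X_int)
  then show ?thesis by (simp add: X_def[abs_def] c_def)
qed

lemma jump_process_expectations:
  fixes V :: "'a \<Rightarrow> real"
  assumes V [measurable]: "V \<in> borel_measurable M" and V_gt_1: "\<And>\<omega>. 1 < V \<omega>"
    and tail: "\<And>v. 1 \<le> v \<Longrightarrow> prob {\<omega> \<in> space M. v < V \<omega>} = v powr (- q)"
    and p: "0 < p" "p < q" and T: "0 < T" and x: "0 \<le> x" and c: "c \<le> 1"
  defines "X \<equiv> \<lambda>t \<omega>. jump_path T x c (V \<omega>) t"
  shows "expect_nonneg M (\<lambda>\<omega>. running_max X T \<omega> powr p) = ereal (x powr p * (q / (q - p)))"
    and "expect_nonneg M (\<lambda>\<omega>. X T \<omega> powr p) = ereal (c powr p * x powr p * (q / (q - p)))"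
proof -
  have moment: "expect_nonneg M (\<lambda>\<omega>. (y * V \<omega>) powr p) = ereal (y powr p * (q / (q - p)))" for y
  proof -
    have "(\<integral>\<^sup>+\<omega>. ennreal ((y * V \<omega>) powr p) \<partial>M)
        = (\<integral>\<^sup>+\<omega>. ennreal (y powr p) * (ennreal (V \<omega> powr p) * indicator {\<omega> \<in> space M. 1 < V \<omega>} \<omega>) \<partial>M)"
      using V_gt_1 by (intro nn_integral_cong) (simp add: powr_mult ennreal_mult)
    also have "\<dots> = ennreal (y powr p) * ennreal (q / (q - p))"
      using powr_tail_partial_moment[OF V tail p, of 1] by (simp add: nn_integral_cmult)
    finally show ?thesis
      using p by (simp add: expect_nonneg_def ennreal_mult[symmetric])
  qed
  have "running_max X T \<omega> = x * V \<omega>" for \<omega>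
    unfolding running_max_def X_def by (rule SUP_jump_path[OF T V_gt_1 x c])
  then show "expect_nonneg M (\<lambda>\<omega>. running_max X T \<omega> powr p) = ereal (x powr p * (q / (q - p)))"
    using moment[of x] by simp
  have "X T \<omega> = x * c * V \<omega>" for \<omega>
    using jump_time(2)[OF T V_gt_1[of \<omega>]] by (simp add: X_def jump_path_def)
  then show "expect_nonneg M (\<lambda>\<omega>. X T \<omega> powr p) = ereal (c powr p * x powr p * (q / (q - p)))"
    using moment[of "x * c"] by (simp add: powr_mult mult_ac)
qed

end

section \<open>Sharpness\<close>

text \<open>Choose \<open>q\<close> so that \<open>(q - 1) / q\<close> exceeds \<open>(p - 1) / p\<close> by the factor \<open>1 + h\<close>. Then
\<open>q / (q - p) = 1 / (h * (p - 1))\<close>, and the expression becomes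
\<open>(((1 + h) powr p - 1) / h - p) / (p - 1)\<close>, a difference quotient of \<open>z powr p\<close> at \<open>1\<close> minus its
limit, up to the factor \<open>1 / (p - 1)\<close>.\<close>

lemma exists_tail_exponent_with_small_gap:
  fixes p \<delta> :: real
  assumes p: "1 < p" and "0 < \<delta>"
  obtains q where "p < q"
    "(p / (p - 1)) powr p * ((q - 1) / q) powr p * (q / (q - p)) - p / (p - 1) - q / (q - p) < \<delta>"
proof -
  have "((\<lambda>z. z powr p) has_real_derivative p * 1 powr (p - 1)) (at 1)"
    by (intro has_real_derivative_powr) simp
  then have "((\<lambda>h. ((1 + h) powr p - 1) / h) \<longlongrightarrow> p) (at 0)"
    by (simp add: DERIV_def)
  then have "((\<lambda>h. ((1 + h) powr p - 1) / h) \<longlongrightarrow> p) (at_right 0)"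
    by (rule filterlim_mono) (auto intro: at_le)
  then have "eventually (\<lambda>h. ((1 + h) powr p - 1) / h < p + \<delta> * (p - 1)) (at_right 0)"
    using assms by (intro order_tendstoD(2)) auto
  moreover have "eventually (\<lambda>h. h < 1 / (p - 1)) (at_right 0)"
    using p by (intro order_tendstoD(2)[OF tendsto_ident_at]) auto
  moreover have "eventually (\<lambda>h. 0 < h) (at_right (0::real))"
    by (rule eventually_at_right_less)
  ultimately have "eventually (\<lambda>h. ((1 + h) powr p - 1) / h < p + \<delta> * (p - 1) \<and> h < 1 / (p - 1) \<and> 0 < h)
      (at_right 0)"
    by eventually_elim simp
  then obtain h where h: "((1 + h) powr p - 1) / h < p + \<delta> * (p - 1)" "h < 1 / (p - 1)" "0 < h"
    using eventually_happens'[OF trivial_limit_at_right_real] by blast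
  \<comment> \<open>\<open>d = p / q\<close>, obtained by solving \<open>(q - 1) / q = (p - 1) / p * (1 + h)\<close> for \<open>q\<close>.\<close>
  define d where "d = 1 - h * (p - 1)"
  have d: "0 < d" "d < 1" using h p by (auto simp: d_def field_simps)
  define q where "q = p / d"
  have "p < q" using d p by (simp add: q_def field_simps)
  have qp: "q / (q - p) = 1 / (h * (p - 1))"
  proof -
    have "q - p = q * (h * (p - 1))" using d by (simp add: q_def field_simps) (simp add: d_def algebra_simps)
    then show ?thesis using \<open>p < q\<close> p by simp
  qed
  have ratio: "p / (p - 1) * ((q - 1) / q) = 1 + h"
  proof -
    have "(q - 1) / q = 1 - d / p" using d p by (simp add: q_def field_simps)
    then have "p / (p - 1) * ((q - 1) / q) = p / (p - 1) * (1 - d / p)" by (simp only:)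
    also have "\<dots> = (p - d) / (p - 1)" using p by (simp add: field_simps)
    also have "p - d = (p - 1) * (1 + h)" by (simp add: d_def algebra_simps)
    finally show ?thesis using p by simp
  qed
  have pw: "(p / (p - 1)) powr p * ((q - 1) / q) powr p = (1 + h) powr p"
    unfolding powr_mult[symmetric] ratio ..
  have "(1 + h) powr p * (1 / (h * (p - 1))) - p / (p - 1) - 1 / (h * (p - 1))
      = (((1 + h) powr p - 1) / h - p) / (p - 1)"
    by (simp add: diff_divide_distrib)
  also have "\<dots> < \<delta>"
  proof -
    have "((1 + h) powr p - 1) / h - p < \<delta> * (p - 1)" using h(1) by linarith
    then show ?thesis using p by (simp only: pos_divide_less_eq diff_gt_0_iff_gt)
  qed
  finally show thesis
    using that[OF \<open>p < q\<close>] unfolding pw qp by simp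
qed

context prob_space
begin

lemma exists_martingale_near_doob_bound:
  fixes Z :: "'a \<Rightarrow> real" and f :: "real \<Rightarrow> real"
  assumes Z: "distributed M lborel Z f" "\<And>z. 0 < f z"
    and T: "0 < T" and x0: "0 \<le> x0" and p: "1 < p" and \<epsilon>: "0 < \<epsilon>"
  shows "\<exists>X. nonneg_process M T X \<and> cadlag M T X \<and> martingale M T X \<and> starts_at M x0 X
    \<and> 0 \<le> doob_bound M T p x0 X - expect_nonneg M (\<lambda>\<omega>. running_max X T \<omega> powr p)
    \<and> doob_bound M T p x0 X - expect_nonneg M (\<lambda>\<omega>. running_max X T \<omega> powr p) < ereal \<epsilon>"
proof -
  \<comment> \<open>The summand \<open>1\<close> keeps the denominator positive when \<open>x0 = 0\<close>.\<close>
  define \<delta> where "\<delta> = \<epsilon> / (x0 powr p + 1)"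
  have \<delta>: "0 < \<delta>" "x0 powr p * \<delta> < \<epsilon>"
  proof -
    have "0 < x0 powr p + 1" by (simp add: add_nonneg_pos)
    then show "0 < \<delta>" "x0 powr p * \<delta> < \<epsilon>"
      using \<epsilon> by (simp_all add: \<delta>_def pos_divide_less_eq algebra_simps)
  qed
  obtain q where q: "p < q" and gap:
    "(p / (p - 1)) powr p * ((q - 1) / q) powr p * (q / (q - p)) - p / (p - 1) - q / (q - p) < \<delta>"
    using exists_tail_exponent_with_small_gap[OF p \<delta>(1)] by blast
  have "0 < q" using p q by simp
  obtain V :: "'a \<Rightarrow> real" where V: "V \<in> borel_measurable M" "\<And>\<omega>. 1 < V \<omega>"
    "\<And>v. 1 \<le> v \<Longrightarrow> prob {\<omega> \<in> space M. v < V \<omega>} = v powr (- q)"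
    using exists_random_variable_with_powr_tail[OF Z \<open>0 < q\<close>] by blast
  define c where "c = (q - 1) / q"
  have c: "0 \<le> c" "c \<le> 1" using p q by (auto simp: c_def)
  define X where "X = (\<lambda>t \<omega>. jump_path T x0 c (V \<omega>) t)"
  have nn: "nonneg_process M T X"
    unfolding nonneg_process_def X_def using jump_path_nonneg[OF T V(2) x0 c(1)] by blast
  have cad: "cadlag M T X"
    unfolding cadlag_iff_cadlag_path X_def using cadlag_jump_path[OF T V(2)] by blast
  have mart: "martingale M T X"
    unfolding X_def c_def using p q by (intro jump_process_martingale V T x0) auto
  have start: "starts_at M x0 X"
    unfolding starts_at_def using jump_time(1)[OF T V(2)] T by (simp add: X_def jump_path_def)
  note sub = martingale_imp_submartingale[OF mart]
  have "0 < p" using p by simp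
  have expect: "expect_nonneg M (\<lambda>\<omega>. running_max X T \<omega> powr p) = ereal (x0 powr p * (q / (q - p)))"
      "expect_nonneg M (\<lambda>\<omega>. X T \<omega> powr p) = ereal (c powr p * x0 powr p * (q / (q - p)))"
    using jump_process_expectations[OF V \<open>0 < p\<close> q T x0 c(2)] by (simp_all add: X_def)
  define gap' where "gap' = (p / (p - 1)) powr p * c powr p * (q / (q - p)) - p / (p - 1) - q / (q - p)"
  have diff: "doob_bound M T p x0 X - expect_nonneg M (\<lambda>\<omega>. running_max X T \<omega> powr p) = ereal (x0 powr p * gap')"
    unfolding doob_bound_def expect gap'_def by (simp add: algebra_simps)
  have "x0 powr p * gap' \<le> x0 powr p * \<delta>"
    using gap by (intro mult_left_mono) (auto simp: gap'_def c_def)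
  then have "x0 powr p * gap' < \<epsilon>" using \<delta>(2) by simp
  moreover have "expect_nonneg M (\<lambda>\<omega>. running_max X T \<omega> powr p) \<le> doob_bound M T p x0 X"
    using expect_running_max_powr_le_UB[OF nn cad sub T x0 \<open>0 < p\<close>, of "(p - 1) / p"]
      UB_le_doob_bound[OF nn sub start _ x0 p] T p by (force intro: order_trans)
  then have "0 \<le> doob_bound M T p x0 X - expect_nonneg M (\<lambda>\<omega>. running_max X T \<omega> powr p)"
    unfolding expect(1) by (cases "doob_bound M T p x0 X") auto
  ultimately show ?thesis
    using nn cad mart start by (intro exI[of _ X]) (simp add: diff)
qed

end

section \<open>Doob's inequality with its intermediate bound\<close>

theorem proposition3p1:
  fixes M :: "'a measure" and F :: "real \<Rightarrow> 'a measure" and B :: "real \<Rightarrow> 'a \<Rightarrow> real"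
    and T X0 p :: real
  assumes "filtered_prob_space M F"
    and "brownian_motion M F X0 B"
    and "0 < T"
    and "0 \<le> X0"
    and "1 < p"
  shows
    "(\<forall>X. nonneg_process M T X \<and> cadlag M T X \<and> submartingale M T X \<and> starts_at M X0 X \<longrightarrow>
        expect_nonneg M (\<lambda>\<omega>. running_max X T \<omega> powr p) \<le> UB M T X0 X (pow p) (zeta ((p - 1) / p))
        \<and> UB M T X0 X (pow p) (zeta ((p - 1) / p)) \<le> doob_bound M T p X0 X)
     \<and>
     (\<forall>\<epsilon>>0. \<exists>X. nonneg_process M T X \<and> cadlag M T X \<and> martingale M T X \<and> starts_at M X0 X
        \<and> 0 \<le> doob_bound M T p X0 X - expect_nonneg M (\<lambda>\<omega>. running_max X T \<omega> powr p)
        \<and> doob_bound M T p X0 X - expect_nonneg M (\<lambda>\<omega>. running_max X T \<omega> powr p) < ereal \<epsilon>)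
     \<and>
     (0 < X0 \<longrightarrow>
       (\<forall>X. nonneg_process M T X \<and> cadlag M T X \<and> submartingale M T X \<and> starts_at M X0 X \<longrightarrow>
         (UB M T X0 X (pow p) (zeta ((p - 1) / p)) < doob_bound M T p X0 X \<longleftrightarrow>
            (expect_nonneg M (\<lambda>\<omega>. running_max X T \<omega> powr p) < \<infinity>
               \<and> 0 < measure M {\<omega> \<in> space M. X T \<omega> < (p - 1) / p * X0})
            \<or> (expect_nonneg M (\<lambda>\<omega>. running_max X T \<omega> powr p) < \<infinity>
               \<and> \<not> martingale M T X))))"
proof -
  interpret prob_space M using assms(1) by (simp add: filtered_prob_space_def)
  have T: "0 < T" "0 \<le> T" and p: "0 < p" "(p - 1) / p < 1" using assms by auto
  have Z: "distributed M lborel (\<lambda>\<omega>. B T \<omega> - B 0 \<omega>) (normal_density 0 (sqrt (T - 0)))"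
    using assms(2) T(1) unfolding brownian_motion_def by blast
  have Z_pos: "0 < normal_density 0 (sqrt (T - 0)) z" for z
    using T by (intro normal_density_pos) simp
  have i: "expect_nonneg M (\<lambda>\<omega>. running_max X T \<omega> powr p) \<le> UB M T X0 X (pow p) (zeta ((p - 1) / p))
      \<and> UB M T X0 X (pow p) (zeta ((p - 1) / p)) \<le> doob_bound M T p X0 X"
    if "nonneg_process M T X \<and> cadlag M T X \<and> submartingale M T X \<and> starts_at M X0 X" for X
    using that expect_running_max_powr_le_UB[OF _ _ _ T(1) \<open>0 \<le> X0\<close> p] UB_le_doob_bound[OF _ _ _ T(2) \<open>0 \<le> X0\<close> \<open>1 < p\<close>]
    by blast
  have iii: "UB M T X0 X (pow p) (zeta ((p - 1) / p)) < doob_bound M T p X0 X \<longleftrightarrow>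
      expect_nonneg M (\<lambda>\<omega>. running_max X T \<omega> powr p) < \<infinity> \<and>
      (0 < measure M {\<omega> \<in> space M. X T \<omega> < (p - 1) / p * X0} \<or> \<not> martingale M T X)"
    if "0 < X0" "nonneg_process M T X \<and> cadlag M T X \<and> submartingale M T X \<and> starts_at M X0 X" for X
    using that UB_less_doob_bound_iff[OF _ _ _ _ T(1) _ \<open>1 < p\<close>] by blast
  show ?thesis
    using i exists_martingale_near_doob_bound[OF Z Z_pos T(1) \<open>0 \<le> X0\<close> \<open>1 < p\<close>] iii by blast
qed

end
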